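(* Let $n,m\geq 1$ be integers. Let $\phi:\mathbb{R}^m\times\mathbb{R}^n\to\mathbb{R}$, $(t,x)\mapsto\phi(t,x)$, be a convex function (jointly in $(t,x)\in\mathbb{R}^{m}\times\mathbb{R}^{n}=\mathbb{R}^{n+m}$) and let $\psi:\mathbb{R}^n\to\mathbb{R}$ be a convex function. Assume that $$\int_{\mathbb{R}^n} e^{\psi(x)-\phi(0,x)}\,dx = 1.$$ Then there exists a convex function $\Psi:\mathbb{R}^m\times\mathbb{R}^n\to\mathbb{R}$ (jointly convex in $(t,x)$) such that $\Psi(0,x)=\psi(x)$ for all $x\in\mathbb{R}^n$ and $$\int_{\mathbb{R}^n} e^{\Psi(t,x)-\phi(t,x)}\,dx\leq 1\qquad\text{for all } t\in\mathbb{R}^m.$$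
   Context: Integrals are with respect to Lebesgue measure $dx$ on $\mathbb{R}^n$. Convex functions are real-valued (finite everywhere). Points of $\mathbb{R}^{n+m}=\mathbb{R}^m_t\times\mathbb{R}^n_x$ are written $(t,x)$ with $t\in\mathbb{R}^m$, $x\in\mathbb{R}^n$. *)

theory Defs
  imports "HOL-Analysis.Analysis"
begin

end

theory Submission
  imports Defs
begin

text \<open>
  Write \<open>\<psi>\<close> as the supremum of countably many affine functions \<open>l\<^sub>k\<close> with distinct slopes, and look for
  \<open>\<Psi>(t, x) = sup\<^sub>k (l\<^sub>k(x) + s\<^sub>k \<bullet> t)\<close>. For a finite set \<open>K\<close> of indices and a finite set \<open>T\<close> of points \<open>t\<close>,
  let \<open>Z(t)\<close> be the integral of \<open>exp (max\<^sub>k (l\<^sub>k(x) + s\<^sub>k \<bullet> t) - \<phi>(t, x))\<close>, and choose the vectors \<open>s\<^sub>k\<close> so that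
  the sum of the \<open>Z(t)^p\<close> over \<open>T\<close> is minimal. Let \<open>M\<^sub>k(t)\<close> be the part of \<open>Z(t)\<close> coming from the cell where
  the \<open>k\<close>-th piece is the maximum. These cells are slices of convex sets, so \<open>M\<^sub>k\<close> is log-concave in \<open>t\<close>
  by the Prekopa--Leindler inequality. The first-order condition says that for each \<open>k\<close> the points of \<open>T\<close>,
  weighted by \<open>Z(t)^(p-1) M\<^sub>k(t)\<close>, have barycentre \<open>0\<close>. Log-concavity thus bounds \<open>M\<^sub>k(0)\<close> from below, and
  since the \<open>M\<^sub>k(0)\<close> sum to at most 1, an entropy inequality gives that the sum of the \<open>Z(t)^p\<close> is at most
  the cardinality of \<open>T\<close>. Letting \<open>p\<close>, \<open>K\<close> and \<open>T\<close> grow, a convergent subsequence of the slopes gives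
  \<open>Z(t) \<le> 1\<close> on a dense set of \<open>t\<close>, hence everywhere by Fatou's lemma.
\<close>

section \<open>The Prekopa--Leindler inequality\<close>

text \<open>One-dimensional Brunn--Minkowski. For \<open>a\<close> in \<open>A\<close> and
  \<open>b\<close> in \<open>B\<close>, the set \<open>C\<close> contains \<open>b\<close> plus the
  part of \<open>A\<close> up to \<open>a\<close>, and \<open>a\<close> plus the part of
  \<open>B\<close> beyond \<open>b\<close>. These translates lie on opposite sides of
  \<open>a + b\<close>, so their measures add; then \<open>a\<close> moves towards the supremum of
  \<open>A\<close> and \<open>b\<close> towards the infimum of \<open>B\<close>.\<close>

lemma emeasure_add_le_of_sumset:
  fixes A B C :: "real set"
  assumes [measurable]: "A \<in> sets borel" "B \<in> sets borel" "C \<in> sets borel"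
    and ne: "A \<noteq> {}" "B \<noteq> {}" and sub: "\<And>a b. a \<in> A \<Longrightarrow> b \<in> B \<Longrightarrow> a + b \<in> C"
  shows "emeasure lborel A + emeasure lborel B \<le> emeasure lborel C"
proof -
  have shift: "emeasure lborel ((\<lambda>x. x - c) -` S) = emeasure lborel S" if "S \<in> sets borel" for S :: "real set" and c
  proof -
    have "emeasure lborel S = emeasure (distr lborel borel ((+) (- c))) S"
      by (simp only: lborel_distr_plus)
    also have "\<dots> = emeasure lborel ((+) (- c) -` S)"
      using that by (subst emeasure_distr) auto
    also have "(+) (- c) -` S = (\<lambda>x. x - c) -` S" by auto
    finally show ?thesis by simp
  qed
  have step: "emeasure lborel (A \<inter> {..a}) + emeasure lborel (B \<inter> {b..}) \<le> emeasure lborel C"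
    if "a \<in> A" "b \<in> B" for a b
  proof -
    let ?A = "(\<lambda>x. x - b) -` (A \<inter> {..a})" and ?B = "(\<lambda>x. x - a) -` (B \<inter> {b<..})"
    have [measurable]: "?A \<in> sets borel" "?B \<in> sets borel"
      by (auto intro!: measurable_sets_borel[where M=borel] simp del: vimage_Int)
    \<comment> \<open>The point \<open>b\<close> is dropped to make the two translates disjoint; it
      has measure zero.\<close>
    have "emeasure lborel (B \<inter> {b..}) \<le> emeasure lborel (B \<inter> {b<..} \<union> {b})"
      by (intro emeasure_mono) auto
    also have "\<dots> \<le> emeasure lborel (B \<inter> {b<..}) + emeasure lborel {b}"
      by (intro emeasure_subadditive) auto
    finally have "emeasure lborel (B \<inter> {b..}) \<le> emeasure lborel (B \<inter> {b<..})" by simp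
    then have "emeasure lborel (A \<inter> {..a}) + emeasure lborel (B \<inter> {b..}) \<le> emeasure lborel ?A + emeasure lborel ?B"
      by (subst shift, simp, subst shift, simp, intro add_left_mono)
    also have "\<dots> = emeasure lborel (?A \<union> ?B)"
      by (intro plus_emeasure) auto
    also have "\<dots> \<le> emeasure lborel C"
    proof (intro emeasure_mono subsetI)
      fix x assume "x \<in> ?A \<union> ?B"
      then show "x \<in> C" using sub[of "x - b" b] sub[of a "x - a"] that by auto
    qed simp
    finally show ?thesis .
  qed
  \<comment> \<open>The cuts have to be made at points of \<open>D\<close>. If \<open>D\<close> has
    a maximum, cut there; otherwise levels \<open>u n\<close> increasing to the supremum, possibly
    infinite, exhaust \<open>D\<close>, and each has a point of \<open>D\<close> at or above
    it.\<close>
  have approx: "\<exists>a. (\<forall>n::nat. a n \<in> D) \<and> (\<lambda>n. emeasure lborel (D \<inter> {..a n})) \<longlonglongrightarrow> emeasure lborel D"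
    if [measurable]: "D \<in> sets borel" and "D \<noteq> {}" for D :: "real set"
  proof (cases "\<exists>a\<in>D. D \<subseteq> {..a}")
    case True
    then obtain a where "a \<in> D" "D \<inter> {..a} = D" by blast
    then show ?thesis by (intro exI[of _ "\<lambda>_. a"]) simp
  next
    case False
    have "\<exists>u. incseq u \<and> (\<forall>n. \<exists>a\<in>D. u n \<le> a) \<and> (\<forall>x\<in>D. \<exists>n. x \<le> u n)"
    proof (cases "bdd_above D")
      case True
      let ?u = "\<lambda>n. Sup D - 1 / real (Suc n)"
      have "incseq ?u" by (auto simp: incseq_def field_simps)
      moreover have "\<exists>a\<in>D. ?u n \<le> a" for n
        using less_cSupD[OF \<open>D \<noteq> {}\<close>, of "?u n"] by (auto intro: less_imp_le)
      moreover have "\<exists>n. x \<le> ?u n" if "x \<in> D" for x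
      proof -
        have "x < Sup D"
          using cSup_upper[OF that True] False that True
          by (metis atMost_iff cSup_upper order_le_less subsetI)
        then obtain n where "1 / real (Suc n) < Sup D - x"
          using reals_Archimedean[of "Sup D - x"] by (auto simp: field_simps)
        then show ?thesis by (intro exI[of _ n]) simp
      qed
      ultimately show ?thesis by blast
    next
      case False
      have "\<exists>a\<in>D. real n \<le> a" for n
        using False unfolding bdd_above_def by (meson linear)
      then show ?thesis
        by (intro exI[of _ real]) (auto simp: incseq_def real_arch_simple)
    qed
    then obtain u where u: "incseq u" "\<And>n. \<exists>a\<in>D. u n \<le> a" "\<And>x. x \<in> D \<Longrightarrow> \<exists>n. x \<le> u n" by blast
    from u(2) obtain a where a: "\<And>n. a n \<in> D" "\<And>n. u n \<le> a n" by metis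
    have "(\<lambda>n. emeasure lborel (D \<inter> {..u n})) \<longlonglongrightarrow> emeasure lborel (\<Union>n. D \<inter> {..u n})"
      using u(1) by (intro Lim_emeasure_incseq) (auto simp: incseq_def intro: order_trans)
    also have "(\<Union>n. D \<inter> {..u n}) = D" using u(3) by auto
    finally have lim: "(\<lambda>n. emeasure lborel (D \<inter> {..u n})) \<longlonglongrightarrow> emeasure lborel D" .
    have "(\<lambda>n. emeasure lborel (D \<inter> {..a n})) \<longlonglongrightarrow> emeasure lborel D"
    proof (rule tendsto_sandwich[OF _ _ lim tendsto_const])
      show "\<forall>\<^sub>F n in sequentially. emeasure lborel (D \<inter> {..u n}) \<le> emeasure lborel (D \<inter> {..a n})"
        using a(2) by (intro always_eventually allI emeasure_mono) (auto intro: order_trans)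
      show "\<forall>\<^sub>F n in sequentially. emeasure lborel (D \<inter> {..a n}) \<le> emeasure lborel D"
        by (intro always_eventually allI emeasure_mono) auto
    qed
    with a(1) show ?thesis by blast
  qed
  \<comment> \<open>Reflection turns cuts of \<open>B\<close> from below into cuts of the reflected
    set from above, so \<open>approx\<close> serves both sets.\<close>
  have neg: "emeasure lborel (uminus -` S) = emeasure lborel S" if "S \<in> sets borel" for S :: "real set"
  proof -
    have "emeasure (distr lborel borel uminus) S = emeasure lborel S"
      by (simp add: lborel_distr_uminus)
    then show ?thesis using that by (simp add: emeasure_distr)
  qed
  obtain a where a: "\<And>n::nat. a n \<in> A" "(\<lambda>n. emeasure lborel (A \<inter> {..a n})) \<longlonglongrightarrow> emeasure lborel A"
    using approx[of A] ne by auto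
  have "uminus -` B \<noteq> {}" using ne(2) by (metis all_not_in_conv minus_minus vimage_eq)
  moreover have "uminus -` B \<in> sets borel" by (auto intro!: measurable_sets_borel[where M=borel])
  ultimately obtain b where b: "\<And>n::nat. b n \<in> uminus -` B"
      "(\<lambda>n. emeasure lborel (uminus -` B \<inter> {..b n})) \<longlonglongrightarrow> emeasure lborel (uminus -` B)"
    using approx[of "uminus -` B"] by blast
  have "uminus -` B \<inter> {..b n} = uminus -` (B \<inter> {- b n..})" for n by auto
  then have b2: "(\<lambda>n. emeasure lborel (B \<inter> {- b n..})) \<longlonglongrightarrow> emeasure lborel B"
    using b(2) by (simp add: neg del: vimage_Int)
  show ?thesis
  proof (rule LIMSEQ_le_const2[OF tendsto_add[OF a(2) b2]])
    show "\<exists>N. \<forall>n\<ge>N. emeasure lborel (A \<inter> {..a n}) + emeasure lborel (B \<inter> {- b n..}) \<le> emeasure lborel C"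
      using step a(1) b(1) by auto
  qed
qed

text \<open>Tonelli's theorem on the region under the graph of \<open>f\<close>; restricting the
  levels to the open unit interval is what truncates \<open>f\<close> at 1.\<close>

lemma nn_integral_layer_cake:
  fixes f :: "real \<Rightarrow> ennreal"
  assumes [measurable]: "f \<in> borel_measurable borel"
  shows "(\<integral>\<^sup>+x. min 1 (f x) \<partial>lborel) =
    (\<integral>\<^sup>+s. indicator {0<..<1} s * emeasure lborel {x. ennreal s < f x} \<partial>lborel)"
proof -
  have [measurable]: "Measurable.pred (borel \<Otimes>\<^sub>M borel) (\<lambda>(x, s). ennreal s < f x)"
    by measurable
  have eq: "min 1 (f x) = (\<integral>\<^sup>+s. indicator {0<..<1} s * indicator {x. ennreal s < f x} x \<partial>lborel)" for x
  proof -
    have "(\<lambda>s. indicator {0<..<1} s * indicator {x. ennreal s < f x} x :: ennreal) =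
      indicator {0<..<enn2real (min 1 (f x))}"
      by (cases "f x") (auto simp: fun_eq_iff min_def ennreal_less_iff top_unique split: split_indicator)
    then show ?thesis by (auto simp: min_def less_top[symmetric] ennreal_enn2real_if)
  qed
  show ?thesis
    unfolding eq
    by (subst lborel_pair.Fubini'[of "\<lambda>s x. indicator {0<..<1} s * indicator {x. ennreal s < f x} x"])
       (auto simp: nn_integral_cmult intro!: nn_integral_cong)
qed

text \<open>At each level \<open>s\<close> between 0 and 1 the sumset bound applies to the
  superlevel sets: the assumption \<open>sup\<close> makes those of \<open>f\<close> and
  \<open>g\<close> nonempty, and \<open>min\<close> puts their sum inside that of \<open>h\<close>.
  Integrate over \<open>s\<close>.\<close>

lemma nn_integral_add_le_of_min:
  fixes f g h :: "real \<Rightarrow> ennreal"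
  assumes [measurable]: "f \<in> borel_measurable borel" "g \<in> borel_measurable borel" "h \<in> borel_measurable borel"
    and le: "\<And>x. f x \<le> 1" "\<And>x. g x \<le> 1"
    and sup: "\<And>s. s < 1 \<Longrightarrow> \<exists>x. s < f x" "\<And>s. s < 1 \<Longrightarrow> \<exists>x. s < g x"
    and min: "\<And>x y. min (f x) (g y) \<le> h (x + y)"
  shows "(\<integral>\<^sup>+x. f x \<partial>lborel) + (\<integral>\<^sup>+x. g x \<partial>lborel) \<le> (\<integral>\<^sup>+x. h x \<partial>lborel)"
proof -
  let ?L = "\<lambda>f s. indicator {0<..<1::real} s * emeasure lborel {x::real. ennreal s < f x}"
  have meas: "?L f \<in> borel_measurable borel" if [measurable]: "f \<in> borel_measurable borel" for f
  proof -
    have "{p \<in> space (borel \<Otimes>\<^sub>M lborel). ennreal (fst p) < f (snd p)} \<in> sets (borel \<Otimes>\<^sub>M lborel)"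
      by measurable
    then have "(\<lambda>s. emeasure lborel (Pair s -` {p. ennreal (fst p) < f (snd p)})) \<in> borel_measurable borel"
      by (intro lborel.measurable_emeasure_Pair) (simp add: space_pair_measure)
    then show ?thesis by (simp add: vimage_def)
  qed
  have "(\<integral>\<^sup>+x. f x \<partial>lborel) + (\<integral>\<^sup>+x. g x \<partial>lborel) = (\<integral>\<^sup>+x. min 1 (f x) \<partial>lborel) + (\<integral>\<^sup>+x. min 1 (g x) \<partial>lborel)"
    using le by (simp add: min_absorb2)
  also have "\<dots> = (\<integral>\<^sup>+s. ?L f s + ?L g s \<partial>lborel)"
    using meas[of f] meas[of g] by (subst (1 2) nn_integral_layer_cake) (auto simp: nn_integral_add)
  also have "\<dots> \<le> (\<integral>\<^sup>+s. ?L h s \<partial>lborel)"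
  proof (intro nn_integral_mono)
    fix s :: real
    show "?L f s + ?L g s \<le> ?L h s"
    proof (cases "s \<in> {0<..<1}")
      case True
      then have "ennreal s < 1" by (simp add: ennreal_less_one_iff)
      then have "emeasure lborel {x. ennreal s < f x} + emeasure lborel {x. ennreal s < g x} \<le> emeasure lborel {x. ennreal s < h x}"
        using sup min by (intro emeasure_add_le_of_sumset) (auto intro: less_le_trans[OF _ min])
      then show ?thesis using True by simp
    qed simp
  qed
  also have "\<dots> = (\<integral>\<^sup>+x. min 1 (h x) \<partial>lborel)" by (simp add: nn_integral_layer_cake)
  also have "\<dots> \<le> (\<integral>\<^sup>+x. h x \<partial>lborel)" by (intro nn_integral_mono) simp
  finally show ?thesis .
qed

text \<open>The inequality \<open>u powr (1 - l) * v powr l \<le> w\<close> for extended nonnegative reals, with the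
  convention \<open>0 * \<infinity> = 0\<close>.\<close>

definition geo_le :: "real \<Rightarrow> ennreal \<Rightarrow> ennreal \<Rightarrow> ennreal \<Rightarrow> bool" where
  "geo_le l u v w \<longleftrightarrow>
    (\<forall>a b. 0 < a \<longrightarrow> 0 < b \<longrightarrow> ennreal a \<le> u \<longrightarrow> ennreal b \<le> v \<longrightarrow> ennreal (a powr (1 - l) * b powr l) \<le> w)"

lemma geo_leD:
  "geo_le l u v w \<Longrightarrow> 0 < a \<Longrightarrow> 0 < b \<Longrightarrow> ennreal a \<le> u \<Longrightarrow> ennreal b \<le> v \<Longrightarrow> ennreal (a powr (1 - l) * b powr l) \<le> w"
  unfolding geo_le_def by blast

lemma geo_le_antimono: "geo_le l u v w \<Longrightarrow> u' \<le> u \<Longrightarrow> v' \<le> v \<Longrightarrow> geo_le l u' v' w"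
  unfolding geo_le_def by (meson order_trans)

text \<open>Multiplying \<open>a\<close> and \<open>b\<close> by \<open>r < 1\<close> makes the
  bounds strict and multiplies the geometric mean by \<open>r\<close>; then \<open>r\<close> tends
  to 1. Strict bounds are what survives when an integral is approximated from below.\<close>

lemma geo_le_strictI:
  assumes "\<And>a b. 0 < a \<Longrightarrow> 0 < b \<Longrightarrow> ennreal a < u \<Longrightarrow> ennreal b < v \<Longrightarrow> ennreal (a powr (1 - l) * b powr l) \<le> w"
  shows "geo_le l u v w"
  unfolding geo_le_def
proof (intro allI impI)
  fix a b :: real
  assume a: "0 < a" "ennreal a \<le> u" and b: "0 < b" "ennreal b \<le> v"
  let ?X = "a powr (1 - l) * b powr l"
  have *: "ennreal (r * ?X) \<le> w" if r: "0 < r" "r < 1" for r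
  proof -
    have "ennreal (r * a) < u" "ennreal (r * b) < v"
      using a b r by (auto intro!: less_le_trans[OF _ a(2)] less_le_trans[OF _ b(2)] simp: ennreal_less_iff)
    then have "ennreal ((r * a) powr (1 - l) * (r * b) powr l) \<le> w"
      using a b r by (intro assms) auto
    also have "(r * a) powr (1 - l) * (r * b) powr l = (r powr (1 - l) * r powr l) * ?X"
      using a b r by (simp add: powr_mult)
    also have "r powr (1 - l) * r powr l = r"
      using r by (simp flip: powr_add)
    finally show ?thesis .
  qed
  show "ennreal ?X \<le> w"
  proof (cases w)
    case (real w')
    have "?X \<le> w'"
      by (rule field_le_mult_one_interval) (use * real in auto)
    then show ?thesis using real by (simp add: ennreal_leI)
  qed simp
qed

text \<open>Once \<open>f\<close> and \<open>g\<close> are normalised to have supremum 1 and the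
  weights are absorbed into the variables, the minimum condition of
  \<open>nn_integral_add_le_of_min\<close> holds. The normalised integral of \<open>h\<close> then
  dominates a weighted arithmetic mean, hence by Young's inequality the geometric mean.\<close>

lemma geo_le_nn_integral_bounded:
  fixes f g h :: "real \<Rightarrow> ennreal"
  assumes l: "0 < l" "l < 1"
    and [measurable]: "f \<in> borel_measurable borel" "g \<in> borel_measurable borel" "h \<in> borel_measurable borel"
    and bd: "\<And>x. f x \<le> ennreal B" "\<And>x. g x \<le> ennreal B"
    and le: "\<And>x y. geo_le l (f x) (g y) (h ((1 - l) * x + l * y))"
  shows "geo_le l (\<integral>\<^sup>+x. f x \<partial>lborel) (\<integral>\<^sup>+x. g x \<partial>lborel) (\<integral>\<^sup>+x. h x \<partial>lborel)"
  unfolding geo_le_def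
proof (intro allI impI)
  fix a b :: real
  assume a: "0 < a" "ennreal a \<le> (\<integral>\<^sup>+x. f x \<partial>lborel)" and b: "0 < b" "ennreal b \<le> (\<integral>\<^sup>+x. g x \<partial>lborel)"
  \<comment> \<open>The supremum is finite by \<open>bd\<close> and nonzero because the integral is
    positive; it need not be attained, hence the quantification over \<open>s < 1\<close>.\<close>
  have sup: "\<exists>F>0. (\<forall>x. f x \<le> ennreal F) \<and> (\<forall>s<1. \<exists>x. s < f x / ennreal F)"
    if bd: "\<And>x. f x \<le> ennreal B" and pos: "(\<integral>\<^sup>+x. f x \<partial>lborel) > 0" for f :: "real \<Rightarrow> ennreal"
  proof -
    have "(SUP x. f x) \<noteq> 0"
    proof
      assume "(SUP x. f x) = 0"
      then have "f x = 0" for x by (metis SUP_upper UNIV_I le_zero_eq)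
      then show False using pos by simp
    qed
    moreover have "(SUP x. f x) \<le> ennreal B" using bd by (intro SUP_least)
    ultimately obtain F where F: "F > 0" "(SUP x. f x) = ennreal F"
      by (cases "SUP x. f x") (auto simp: top_unique)
    have "\<exists>x. s < f x / ennreal F" if "s < 1" for s
    proof -
      obtain r where r: "s = ennreal r" "r \<ge> 0" "r < 1"
        using \<open>s < 1\<close> by (cases s) (auto simp: ennreal_less_one_iff)
      have "ennreal (r * F) < (SUP x. f x)"
        using r F by (simp add: ennreal_less_iff)
      then obtain x where x: "ennreal (r * F) < f x" by (auto simp: less_SUP_iff)
      have "f x \<le> ennreal F" using F(2) by (metis SUP_upper UNIV_I)
      with x obtain y where y: "f x = ennreal y" "y > r * F" "y \<ge> 0"
        using mult_nonneg_nonneg[OF r(2) less_imp_le[OF F(1)]]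
        by (cases "f x") (auto simp: ennreal_less_iff top_unique)
      then have "s < f x / ennreal F"
        using r F by (simp add: divide_ennreal ennreal_less_iff field_simps)
      then show ?thesis ..
    qed
    with F show ?thesis by (metis SUP_upper UNIV_I)
  qed
  obtain F where F: "F > 0" "\<And>x. f x \<le> ennreal F" "\<And>s. s < 1 \<Longrightarrow> \<exists>x. s < f x / ennreal F"
    using sup[of f, OF bd(1)] a by (metis ennreal_less_zero_iff less_le_trans)
  obtain G where G: "G > 0" "\<And>x. g x \<le> ennreal G" "\<And>s. s < 1 \<Longrightarrow> \<exists>x. s < g x / ennreal G"
    using sup[of g, OF bd(2)] b by (metis ennreal_less_zero_iff less_le_trans)
  \<comment> \<open>\<open>c\<close> is the scale of \<open>h\<close> that matches the scales
    \<open>F\<close> of \<open>f\<close> and \<open>G\<close> of \<open>g\<close>. The substitutions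
    \<open>u / (1 - l)\<close> and \<open>u / l\<close> below turn the convex combination of the
    arguments into a plain sum.\<close>
  define c where "c = F powr (1 - l) * G powr l"
  have c: "c > 0" using F G by (simp add: c_def)
  define f2 g2 h2 where "f2 = (\<lambda>u. f (u / (1 - l)) / ennreal F)" and "g2 = (\<lambda>u. g (u / l) / ennreal G)"
    and "h2 = (\<lambda>u. h u / ennreal c)"
  have [measurable]: "f2 \<in> borel_measurable borel" "g2 \<in> borel_measurable borel" "h2 \<in> borel_measurable borel"
    unfolding f2_def g2_def h2_def by measurable
  have "(\<integral>\<^sup>+x. f2 x \<partial>lborel) + (\<integral>\<^sup>+x. g2 x \<partial>lborel) \<le> (\<integral>\<^sup>+x. h2 x \<partial>lborel)"
  proof (rule nn_integral_add_le_of_min)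
    show "f2 x \<le> 1" for x
      using F by (simp add: f2_def divide_le_posI_ennreal)
    show "g2 x \<le> 1" for x
      using G by (simp add: g2_def divide_le_posI_ennreal)
    show "\<exists>x. s < f2 x" if "s < 1" for s
    proof -
      obtain x where "s < f x / ennreal F" using F(3) \<open>s < 1\<close> by blast
      then show ?thesis using l by (intro exI[of _ "x * (1 - l)"]) (simp add: f2_def)
    qed
    show "\<exists>x. s < g2 x" if "s < 1" for s
    proof -
      obtain x where "s < g x / ennreal G" using G(3) \<open>s < 1\<close> by blast
      then show ?thesis using l by (intro exI[of _ "x * l"]) (simp add: g2_def)
    qed
    fix u v :: real
    let ?x = "u / (1 - l)" and ?y = "v / l"
    obtain p where p: "f ?x = ennreal p" "p \<ge> 0"
      using F(2)[of ?x] by (cases "f ?x") (auto simp: top_unique)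
    obtain q where q: "g ?y = ennreal q" "q \<ge> 0"
      using G(2)[of ?y] by (cases "g ?y") (auto simp: top_unique)
    show "min (f2 u) (g2 v) \<le> h2 (u + v)"
    proof (cases "p = 0 \<or> q = 0")
      case True
      then show ?thesis using p q by (auto simp: f2_def g2_def)
    next
      case False
      then have pq: "p > 0" "q > 0" using p q by auto
      let ?m = "min (p / F) (q / G)"
      have m: "?m > 0" using pq F G by simp
      have "(1 - l) * ?x + l * ?y = u + v" using l by simp
      then have "ennreal (p powr (1 - l) * q powr l) \<le> h (u + v)"
        using geo_leD[OF le[of ?x ?y], of p q] pq p q by simp
      \<comment> \<open>A minimum is at most any weighted geometric mean of the same two
        numbers.\<close>
      moreover have "?m * c \<le> p powr (1 - l) * q powr l"
      proof -
        have "?m = ?m powr (1 - l) * ?m powr l" using m by (simp flip: powr_add)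
        also have "\<dots> \<le> (p / F) powr (1 - l) * (q / G) powr l"
          using m l by (intro mult_mono powr_mono2) auto
        finally have "?m * c \<le> ((p / F) powr (1 - l) * (q / G) powr l) * c"
          using c by (intro mult_right_mono) auto
        also have "\<dots> = p powr (1 - l) * q powr l"
          using pq F G by (simp add: c_def powr_divide)
        finally show ?thesis .
      qed
      ultimately have "ennreal (?m * c) \<le> h (u + v)"
        by (meson ennreal_leI order_trans)
      then have "ennreal (?m * c) / ennreal c \<le> h2 (u + v)"
        unfolding h2_def by (rule divide_right_mono_ennreal)
      then have "ennreal ?m \<le> h2 (u + v)"
        using c m by (simp add: divide_ennreal)
      moreover have "min (f2 u) (g2 v) = ennreal ?m"
        using p q pq F G by (auto simp: f2_def g2_def divide_ennreal min_def)
      ultimately show ?thesis by simp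
    qed
  qed measurable
  moreover have "(\<integral>\<^sup>+x. f2 x \<partial>lborel) = ennreal (1 - l) * (\<integral>\<^sup>+x. f x \<partial>lborel) / ennreal F"
    using l by (subst nn_integral_real_affine[where c="1 - l" and t=0]) (auto simp: f2_def nn_integral_divide ennreal_times_divide)
  moreover have "(\<integral>\<^sup>+x. g2 x \<partial>lborel) = ennreal l * (\<integral>\<^sup>+x. g x \<partial>lborel) / ennreal G"
    using l by (subst nn_integral_real_affine[where c="l" and t=0]) (auto simp: g2_def nn_integral_divide ennreal_times_divide)
  moreover have "(\<integral>\<^sup>+x. h2 x \<partial>lborel) = (\<integral>\<^sup>+x. h x \<partial>lborel) / ennreal c"
    by (simp add: h2_def nn_integral_divide)
  moreover have "ennreal ((1 - l) * (a / F)) \<le> ennreal (1 - l) * (\<integral>\<^sup>+x. f x \<partial>lborel) / ennreal F"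
  proof -
    have "ennreal ((1 - l) * (a / F)) = ennreal (1 - l) * ennreal a / ennreal F"
      using l a F by (simp add: divide_ennreal ennreal_mult[symmetric])
    also have "\<dots> \<le> ennreal (1 - l) * (\<integral>\<^sup>+x. f x \<partial>lborel) / ennreal F"
      by (intro divide_right_mono_ennreal mult_left_mono a) auto
    finally show ?thesis .
  qed
  moreover have "ennreal (l * (b / G)) \<le> ennreal l * (\<integral>\<^sup>+x. g x \<partial>lborel) / ennreal G"
  proof -
    have "ennreal (l * (b / G)) = ennreal l * ennreal b / ennreal G"
      using l b G by (simp add: divide_ennreal ennreal_mult[symmetric])
    also have "\<dots> \<le> ennreal l * (\<integral>\<^sup>+x. g x \<partial>lborel) / ennreal G"
      by (intro divide_right_mono_ennreal mult_left_mono b) auto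
    finally show ?thesis .
  qed
  ultimately have "ennreal ((1 - l) * (a / F)) + ennreal (l * (b / G)) \<le> (\<integral>\<^sup>+x. h x \<partial>lborel) / ennreal c"
    by (metis (no_types, lifting) add_mono order_trans)
  moreover have "(a / F) powr (1 - l) * (b / G) powr l \<le> (1 - l) * (a / F) + l * (b / G)"
    using Youngs_inequality_0[of "1 - l" l "a / F" "b / G"] l a b F G by simp
  ultimately have "ennreal ((a / F) powr (1 - l) * (b / G) powr l) \<le> (\<integral>\<^sup>+x. h x \<partial>lborel) / ennreal c"
    using l a b F G by (simp add: ennreal_plus[symmetric] del: ennreal_plus) (meson ennreal_leI order_trans)
  then have "ennreal ((a / F) powr (1 - l) * (b / G) powr l) * ennreal c \<le> (\<integral>\<^sup>+x. h x \<partial>lborel) / ennreal c * ennreal c"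
    by (intro mult_right_mono) auto
  also have "\<dots> = (\<integral>\<^sup>+x. h x \<partial>lborel)"
    using c by (simp add: ennreal_divide_times)
  also have "ennreal ((a / F) powr (1 - l) * (b / G) powr l) * ennreal c = ennreal (a powr (1 - l) * b powr l)"
    using a b F G by (simp add: c_def powr_divide flip: ennreal_mult)
  finally show "ennreal (a powr (1 - l) * b powr l) \<le> (\<integral>\<^sup>+x. h x \<partial>lborel)" .
qed

text \<open>Truncate \<open>f\<close> and \<open>g\<close> at integer heights. By monotone
  convergence a strict lower bound on an integral already holds at some finite height, where the
  bounded case applies.\<close>

lemma geo_le_nn_integral_real:
  fixes f g h :: "real \<Rightarrow> ennreal"
  assumes l: "0 < l" "l < 1"
    and [measurable]: "f \<in> borel_measurable borel" "g \<in> borel_measurable borel" "h \<in> borel_measurable borel"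
    and le: "\<And>x y. geo_le l (f x) (g y) (h ((1 - l) * x + l * y))"
  shows "geo_le l (\<integral>\<^sup>+x. f x \<partial>lborel) (\<integral>\<^sup>+x. g x \<partial>lborel) (\<integral>\<^sup>+x. h x \<partial>lborel)"
proof (rule geo_le_strictI)
  fix a b :: real
  assume a: "0 < a" "ennreal a < (\<integral>\<^sup>+x. f x \<partial>lborel)" and b: "0 < b" "ennreal b < (\<integral>\<^sup>+x. g x \<partial>lborel)"
  have trunc: "(\<integral>\<^sup>+x. f x \<partial>lborel) = (SUP n. \<integral>\<^sup>+x. min (f x) (of_nat n) \<partial>lborel)"
    if [measurable]: "f \<in> borel_measurable borel" for f :: "real \<Rightarrow> ennreal"
  proof -
    have "f x = (SUP n. min (f x) (of_nat n))" for x
      by (simp add: inf_min[symmetric] inf_SUP[symmetric] ennreal_SUP_of_nat_eq_top)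
    then have "(\<integral>\<^sup>+x. f x \<partial>lborel) = (\<integral>\<^sup>+x. (SUP n. min (f x) (of_nat n)) \<partial>lborel)"
      by simp
    also have "\<dots> = (SUP n. \<integral>\<^sup>+x. min (f x) (of_nat n) \<partial>lborel)"
      by (intro nn_integral_monotone_convergence_SUP)
         (auto simp: incseq_def le_fun_def min.coboundedI2)
    finally show ?thesis .
  qed
  obtain n where n: "ennreal a < (\<integral>\<^sup>+x. min (f x) (of_nat n) \<partial>lborel)"
    using a by (subst (asm) trunc) (auto simp: less_SUP_iff)
  obtain m where m: "ennreal b < (\<integral>\<^sup>+x. min (g x) (of_nat m) \<partial>lborel)"
    using b by (subst (asm) trunc) (auto simp: less_SUP_iff)
  have "geo_le l (\<integral>\<^sup>+x. min (f x) (of_nat n) \<partial>lborel) (\<integral>\<^sup>+x. min (g x) (of_nat m) \<partial>lborel) (\<integral>\<^sup>+x. h x \<partial>lborel)"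
  proof (rule geo_le_nn_integral_bounded[OF l, where B="real (max n m)"])
    show "min (f x) (of_nat n) \<le> ennreal (real (max n m))" "min (g x) (of_nat m) \<le> ennreal (real (max n m))" for x
      by (auto simp: min.coboundedI2 simp flip: ennreal_of_nat_eq_real_of_nat)
    show "geo_le l (min (f x) (of_nat n)) (min (g y) (of_nat m)) (h ((1 - l) * x + l * y))" for x y
      by (rule geo_le_antimono[OF le]) auto
  qed measurable
  then show "ennreal (a powr (1 - l) * b powr l) \<le> (\<integral>\<^sup>+x. h x \<partial>lborel)"
    using a b n m by (intro geo_leD[where l=l]) auto
qed

section \<open>From one dimension to Euclidean spaces\<close>

interpretation lborel_product: product_sigma_finite "\<lambda>_::'i. lborel :: real measure" ..

text \<open>Induction on the coordinates: by the one-dimensional inequality, the functions obtained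
  by integrating out coordinate \<open>i\<close> again satisfy the pointwise hypothesis, now over
  \<open>I\<close>.\<close>

lemma geo_le_nn_integral_PiM:
  fixes f g h :: "('i \<Rightarrow> real) \<Rightarrow> ennreal"
  assumes l: "0 < l" "l < 1" and "finite I"
    and "f \<in> borel_measurable (PiM I (\<lambda>_. lborel))" "g \<in> borel_measurable (PiM I (\<lambda>_. lborel))"
      "h \<in> borel_measurable (PiM I (\<lambda>_. lborel))"
    and "\<And>x y. x \<in> space (PiM I (\<lambda>_. lborel)) \<Longrightarrow> y \<in> space (PiM I (\<lambda>_. lborel)) \<Longrightarrow>
      geo_le l (f x) (g y) (h (\<lambda>i\<in>I. (1 - l) * x i + l * y i))"
  shows "geo_le l (\<integral>\<^sup>+x. f x \<partial>PiM I (\<lambda>_. lborel)) (\<integral>\<^sup>+x. g x \<partial>PiM I (\<lambda>_. lborel)) (\<integral>\<^sup>+x. h x \<partial>PiM I (\<lambda>_. lborel))"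
  using assms(3-)
proof (induction I arbitrary: f g h)
  case empty
  \<comment> \<open>The product over the empty index set has the single point
    \<open>\<lambda>_. undefined\<close>, where the pointwise hypothesis is the claim
    itself.\<close>
  have "(\<lambda>i\<in>{}. (1 - l) * undefined i + l * undefined i) = (\<lambda>_. undefined :: real)"
    by (simp add: restrict_def)
  then show ?case
    using empty(4)[of "\<lambda>_. undefined" "\<lambda>_. undefined"]
    by (simp add: lborel_product.nn_integral_empty space_PiM restrict_def)
next
  case (insert i I)
  note [measurable] = insert.prems(1-3)
  show ?case
    unfolding lborel_product.product_nn_integral_insert[OF insert.hyps insert.prems(1)]
      lborel_product.product_nn_integral_insert[OF insert.hyps insert.prems(2)]
      lborel_product.product_nn_integral_insert[OF insert.hyps insert.prems(3)]
  proof (rule insert.IH)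
    fix x y assume xy: "x \<in> space (PiM I (\<lambda>_. lborel :: real measure))" "y \<in> space (PiM I (\<lambda>_. lborel :: real measure))"
    let ?z = "\<lambda>i\<in>I. (1 - l) * x i + l * y i"
    have z: "?z \<in> space (PiM I (\<lambda>_. lborel :: real measure))" by (simp add: space_PiM)
    have [measurable]: "(\<lambda>u. w(i := u)) \<in> measurable borel (PiM (insert i I) (\<lambda>_. lborel))"
      if "w \<in> space (PiM I (\<lambda>_. lborel :: real measure))" for w
      using that by (intro measurable_fun_upd[where J=I]) auto
    show "geo_le l (\<integral>\<^sup>+u. f (x(i := u)) \<partial>lborel) (\<integral>\<^sup>+u. g (y(i := u)) \<partial>lborel) (\<integral>\<^sup>+u. h (?z(i := u)) \<partial>lborel)"
    proof (rule geo_le_nn_integral_real[OF l])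
      fix u v :: real
      have "?z(i := (1 - l) * u + l * v) = (\<lambda>j\<in>insert i I. (1 - l) * (x(i := u)) j + l * (y(i := v)) j)"
        using insert.hyps by (auto simp: fun_eq_iff)
      moreover have "x(i := u) \<in> space (PiM (insert i I) (\<lambda>_. lborel))" "y(i := v) \<in> space (PiM (insert i I) (\<lambda>_. lborel))"
        using xy by (auto simp: space_PiM PiE_def extensional_def)
      ultimately show "geo_le l (f (x(i := u))) (g (y(i := v))) (h (?z(i := (1 - l) * u + l * v)))"
        using insert.prems(4)[of "x(i := u)" "y(i := v)"] by (simp only:)
    qed (use xy z in measurable)
  qed measurable
qed

text \<open>The coordinate map \<open>?e\<close> carries the product measure to
  \<open>lborel\<close> and respects convex combinations, so the product version transfers.\<close>

theorem prekopa_leindler: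
  fixes f g h :: "'a::euclidean_space \<Rightarrow> ennreal"
  assumes l: "0 < l" "l < 1"
    and [measurable]: "f \<in> borel_measurable borel" "g \<in> borel_measurable borel" "h \<in> borel_measurable borel"
    and le: "\<And>x y. geo_le l (f x) (g y) (h ((1 - l) *\<^sub>R x + l *\<^sub>R y))"
  shows "geo_le l (\<integral>\<^sup>+x. f x \<partial>lborel) (\<integral>\<^sup>+x. g x \<partial>lborel) (\<integral>\<^sup>+x. h x \<partial>lborel)"
proof -
  let ?P = "\<Pi>\<^sub>M b\<in>(Basis::'a set). (lborel :: real measure)" and ?e = "\<lambda>f. \<Sum>b\<in>(Basis::'a set). f b *\<^sub>R b :: 'a"
  have [measurable]: "?e \<in> measurable ?P borel" by measurable
  have eq: "(\<integral>\<^sup>+x. f x \<partial>lborel) = (\<integral>\<^sup>+x. f (?e x) \<partial>?P)" if [measurable]: "f \<in> borel_measurable borel" for f :: "'a \<Rightarrow> ennreal"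
    by (subst lborel_eq, subst nn_integral_distr) measurable
  show ?thesis
    unfolding eq[OF assms(3)] eq[OF assms(4)] eq[OF assms(5)]
  proof (rule geo_le_nn_integral_PiM[OF l])
    fix x y
    have "?e (\<lambda>b\<in>Basis. (1 - l) * x b + l * y b) = (1 - l) *\<^sub>R ?e x + l *\<^sub>R ?e y"
      by (simp add: scaleR_sum_right sum.distrib[symmetric] scaleR_add_left)
    then show "geo_le l (f (?e x)) (g (?e y)) (h (?e (\<lambda>b\<in>Basis. (1 - l) * x b + l * y b)))"
      using le by simp
  qed (simp, measurable)
qed

text \<open>Prekopa's theorem on marginals. Convexity of \<open>S\<close> and concavity of
  \<open>u\<close> make the integrand jointly log-concave, so its three slices satisfy the
  hypothesis of Prekopa--Leindler.\<close>

lemma marginal_log_concave: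
  fixes u :: "'a::euclidean_space \<times> 'b::euclidean_space \<Rightarrow> real"
  assumes u: "concave_on UNIV u" and S: "convex S" "S \<in> sets borel" and l: "0 < l" "l < 1"
  shows "geo_le l (\<integral>\<^sup>+x. ennreal (indicator S (t, x) * exp (u (t, x))) \<partial>lborel)
    (\<integral>\<^sup>+x. ennreal (indicator S (t', x) * exp (u (t', x))) \<partial>lborel)
    (\<integral>\<^sup>+x. ennreal (indicator S ((1 - l) *\<^sub>R t + l *\<^sub>R t', x) * exp (u ((1 - l) *\<^sub>R t + l *\<^sub>R t', x))) \<partial>lborel)"
proof (rule prekopa_leindler[OF l])
  have "continuous_on UNIV (\<lambda>z. - u z)"
    using u by (intro convex_on_continuous) (auto simp: concave_on_def)
  then have cont: "continuous_on UNIV u"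
    using continuous_on_minus by fastforce
  have [measurable]: "u \<in> borel_measurable borel"
    using cont by (rule borel_measurable_continuous_onI)
  note S(2)[measurable]
  have [measurable]: "Pair t \<in> measurable borel (borel :: ('a \<times> 'b) measure)" for t
    by (intro borel_measurable_continuous_onI continuous_intros)
  show "(\<lambda>x. ennreal (indicator S (t, x) * exp (u (t, x)))) \<in> borel_measurable borel" for t
    by measurable
  show "(\<lambda>x. ennreal (indicator S (t, x) * exp (u (t, x)))) \<in> borel_measurable borel" for t
    by measurable
  show "(\<lambda>x. ennreal (indicator S (t, x) * exp (u (t, x)))) \<in> borel_measurable borel" for t
    by measurable
  fix x y :: 'b
  let ?t = "(1 - l) *\<^sub>R t + l *\<^sub>R t'" and ?x = "(1 - l) *\<^sub>R x + l *\<^sub>R y"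
  show "geo_le l (ennreal (indicator S (t, x) * exp (u (t, x)))) (ennreal (indicator S (t', y) * exp (u (t', y))))
    (ennreal (indicator S (?t, ?x) * exp (u (?t, ?x))))"
    unfolding geo_le_def
  proof (intro allI impI)
    fix a b :: real
    assume a: "0 < a" "ennreal a \<le> ennreal (indicator S (t, x) * exp (u (t, x)))"
      and b: "0 < b" "ennreal b \<le> ennreal (indicator S (t', y) * exp (u (t', y)))"
    have a': "(t, x) \<in> S" "a \<le> exp (u (t, x))"
      using a by (auto split: split_indicator_asm)
    have b': "(t', y) \<in> S" "b \<le> exp (u (t', y))"
      using b by (auto split: split_indicator_asm)
    have "(1 - l) *\<^sub>R (t, x) + l *\<^sub>R (t', y) \<in> S"
      using S(1) a'(1) b'(1) l by (intro convexD) auto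
    then have mem: "(?t, ?x) \<in> S" by simp
    have "a powr (1 - l) * b powr l \<le> exp (u (t, x)) powr (1 - l) * exp (u (t', y)) powr l"
      using a a' b b' l by (intro mult_mono powr_mono2) auto
    also have "\<dots> = exp ((1 - l) * u (t, x) + l * u (t', y))"
      by (simp add: powr_def exp_add)
    also have "\<dots> \<le> exp (u (?t, ?x))"
      using concave_onD[OF u, of l "(t, x)" "(t', y)"] l by simp
    finally show "ennreal (a powr (1 - l) * b powr l) \<le> ennreal (indicator S (?t, ?x) * exp (u (?t, ?x)))"
      using mem by (simp add: ennreal_leI)
  qed
qed

section \<open>Analytic preliminaries\<close>

text \<open>Where \<open>A x\<close> and \<open>R x\<close> differ, the same branch of the maximum
  stays active for all small \<open>\<epsilon>\<close>, so the pointwise derivative is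
  \<open>a * A x\<close> or 0. Dominated convergence along null sequences moves the derivative
  inside the integral.\<close>

lemma has_derivative_integral_max:
  fixes A R :: "'b \<Rightarrow> real"
  assumes A: "integrable M A" and R: "integrable M R" and pos: "\<And>x. 0 < A x"
    and ne: "AE x in M. A x \<noteq> R x"
  shows "((\<lambda>\<epsilon>. \<integral>x. max (exp (\<epsilon> * a) * A x) (R x) \<partial>M) has_real_derivative
    a * (\<integral>x. indicator {x. R x < A x} x * A x \<partial>M)) (at 0)"
proof -
  note [measurable] = borel_measurable_integrable[OF A] borel_measurable_integrable[OF R]
  let ?f = "\<lambda>\<epsilon> x. max (exp (\<epsilon> * a) * A x) (R x)" and ?g = "\<lambda>x. a * (indicator {x. R x < A x} x * A x)"
  have int: "integrable M (?f \<epsilon>)" for \<epsilon>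
    using A R by (intro integrable_max integrable_mult_right)
  have "((\<lambda>h. ((\<integral>x. ?f h x \<partial>M) - (\<integral>x. ?f 0 x \<partial>M)) / h) \<longlongrightarrow> (\<integral>x. ?g x \<partial>M)) (at 0)"
    unfolding tendsto_at_iff_sequentially
  proof (intro allI impI)
    fix X :: "nat \<Rightarrow> real" assume X0: "\<forall>i. X i \<in> UNIV - {0}" and X: "X \<longlonglongrightarrow> 0"
    then have X0: "\<And>i. X i \<noteq> 0" by simp
    obtain C where C: "C > 0" "\<And>n. \<bar>X n\<bar> \<le> C"
      using convergent_imp_Bseq[OF convergentI[OF X]] by (auto simp: Bseq_def)
    have "(\<lambda>n. \<integral>x. (?f (X n) x - ?f 0 x) / X n \<partial>M) \<longlonglongrightarrow> (\<integral>x. ?g x \<partial>M)"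
    proof (rule integral_dominated_convergence)
      show "integrable M (\<lambda>x. (\<bar>a\<bar> * exp (C * \<bar>a\<bar>)) * A x)" using A by simp
      show "AE x in M. (\<lambda>n. (?f (X n) x - ?f 0 x) / X n) \<longlonglongrightarrow> ?g x"
        using ne
      proof eventually_elim
        case (elim x)
        have tend: "((\<lambda>\<epsilon>. exp (\<epsilon> * a) * A x) \<longlongrightarrow> exp (0 * a) * A x) (at 0)"
          by (intro tendsto_intros)
        have "((\<lambda>\<epsilon>. (?f \<epsilon> x - ?f 0 x) / \<epsilon>) \<longlongrightarrow> ?g x) (at 0)"
        proof (cases "R x < A x")
          case True
          have "((\<lambda>\<epsilon>. exp (\<epsilon> * a) * A x) has_real_derivative a * A x) (at 0)"
            by (auto intro!: derivative_eq_intros)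
          then have "((\<lambda>\<epsilon>. (exp (\<epsilon> * a) * A x - A x) / \<epsilon>) \<longlongrightarrow> a * A x) (at 0)"
            by (simp add: DERIV_def)
          moreover have "\<forall>\<^sub>F \<epsilon> in at 0. (exp (\<epsilon> * a) * A x - A x) / \<epsilon> = (?f \<epsilon> x - ?f 0 x) / \<epsilon>"
          proof -
            have "\<forall>\<^sub>F \<epsilon> in at 0. R x < exp (\<epsilon> * a) * A x"
              using order_tendstoD(1)[OF tend] True by simp
            then show ?thesis by eventually_elim (use True in auto)
          qed
          ultimately show ?thesis using True by (simp add: Lim_transform_eventually)
        next
          case False
          then have less: "A x < R x" using elim by simp
          have "\<forall>\<^sub>F \<epsilon> in at 0. 0 = (?f \<epsilon> x - ?f 0 x) / \<epsilon>"
          proof -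
            have "\<forall>\<^sub>F \<epsilon> in at 0. exp (\<epsilon> * a) * A x < R x"
              using order_tendstoD(2)[OF tend] less by simp
            then show ?thesis by eventually_elim (use less in auto)
          qed
          then have "((\<lambda>\<epsilon>. (?f \<epsilon> x - ?f 0 x) / \<epsilon>) \<longlongrightarrow> 0) (at 0)"
            by (rule Lim_transform_eventually[OF tendsto_const])
          then show ?thesis using False by simp
        qed
        then show ?case
          unfolding tendsto_at_iff_sequentially comp_def using X X0 by simp
      qed
      fix n
      have "\<bar>?f (X n) x - ?f 0 x\<bar> \<le> \<bar>X n\<bar> * (\<bar>a\<bar> * exp (C * \<bar>a\<bar>) * A x)" for x
      proof -
        \<comment> \<open>After division by the absolute value of \<open>X n\<close> this leaves a
          dominating function independent of \<open>n\<close>, because \<open>C\<close> bounds the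
          whole sequence \<open>X\<close>.\<close>
        have "\<bar>exp v - 1\<bar> \<le> \<bar>v\<bar> * exp \<bar>v\<bar>" for v :: real
        proof (cases "v \<ge> 0")
          case True
          have "(1 - v) * exp v \<le> exp (- v) * exp v"
            using exp_ge_add_one_self[of "- v"] by (intro mult_right_mono) auto
          then show ?thesis using True by (simp add: algebra_simps flip: exp_add)
        next
          case False
          have "\<bar>v\<bar> * 1 \<le> \<bar>v\<bar> * exp \<bar>v\<bar>" by (intro mult_left_mono) auto
          moreover have "1 + v \<le> exp v" "exp v \<le> 1" using False by auto
          ultimately show ?thesis using False by linarith
        qed
        from this[of "X n * a"] have "\<bar>exp (X n * a) - 1\<bar> \<le> \<bar>X n\<bar> * \<bar>a\<bar> * exp (\<bar>X n\<bar> * \<bar>a\<bar>)"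
          by (simp add: abs_mult)
        also have "\<dots> \<le> \<bar>X n\<bar> * \<bar>a\<bar> * exp (C * \<bar>a\<bar>)"
          using C by (intro mult_left_mono) (auto intro: mult_right_mono)
        finally have "\<bar>exp (X n * a) - 1\<bar> * A x \<le> (\<bar>X n\<bar> * \<bar>a\<bar> * exp (C * \<bar>a\<bar>)) * A x"
          using pos[of x] by (intro mult_right_mono) auto
        moreover have "\<bar>?f (X n) x - ?f 0 x\<bar> \<le> \<bar>exp (X n * a) * A x - A x\<bar>"
          by auto
        moreover have "\<bar>exp (X n * a) * A x - A x\<bar> = \<bar>exp (X n * a) - 1\<bar> * A x"
        proof -
          have "exp (X n * a) * A x - A x = (exp (X n * a) - 1) * A x" by (simp add: left_diff_distrib)
          then show ?thesis using pos[of x] by (simp only: abs_mult abs_of_pos)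
        qed
        ultimately show ?thesis by (simp add: mult.assoc)
      qed
      then show "AE x in M. norm ((?f (X n) x - ?f 0 x) / X n) \<le> \<bar>a\<bar> * exp (C * \<bar>a\<bar>) * A x"
        using X0[of n] by (auto simp: field_simps)
    qed measurable
    moreover have "(\<integral>x. (?f (X n) x - ?f 0 x) / X n \<partial>M) = ((\<integral>x. ?f (X n) x \<partial>M) - (\<integral>x. ?f 0 x \<partial>M)) / X n" for n
      using int[of "X n"] int[of 0] by simp
    ultimately show "((\<lambda>h. ((\<integral>x. ?f h x \<partial>M) - (\<integral>x. ?f 0 x \<partial>M)) / h) \<circ> X) \<longlonglongrightarrow> (\<integral>x. ?g x \<partial>M)"
      by (simp only: comp_def)
  qed
  moreover have "(\<integral>x. ?g x \<partial>M) = a * (\<integral>x. indicator {x. R x < A x} x * A x \<partial>M)" by simp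
  ultimately show ?thesis unfolding DERIV_def by simp
qed

text \<open>Tychonoff's theorem replaces a diagonal argument: the product of the balls is compact,
  hence sequentially compact, and convergence in the product is coordinatewise.\<close>

lemma bounded_coordinates_subseq:
  fixes S :: "nat \<Rightarrow> nat \<Rightarrow> 'a::euclidean_space"
  assumes "\<And>n k. norm (S n k) \<le> B k"
  shows "\<exists>s r. strict_mono r \<and> (\<forall>k. (\<lambda>n. S (r n) k) \<longlonglongrightarrow> s k)"
proof -
  have "compactin (product_topology (\<lambda>_. euclidean) UNIV) (PiE UNIV (\<lambda>k. cball (0::'a) (B k)))"
    by (simp add: compactin_PiE)
  then have "compact (PiE UNIV (\<lambda>k. cball (0::'a) (B k)))"
    by (simp add: euclidean_product_topology)
  then have "seq_compact (PiE UNIV (\<lambda>k. cball (0::'a) (B k)))"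
    by (rule compact_imp_seq_compact)
  moreover have "\<forall>n. S n \<in> PiE UNIV (\<lambda>k. cball 0 (B k))" using assms by auto
  ultimately obtain s r where r: "strict_mono r" "(S \<circ> r) \<longlonglongrightarrow> s"
    unfolding seq_compact_def by blast
  have "(\<lambda>n. S (r n) k) \<longlonglongrightarrow> s k" for k
    using continuous_on_tendsto_compose[OF continuous_on_product_coordinates[of k] r(2)]
    by (simp add: comp_def)
  with r(1) show ?thesis by blast
qed

text \<open>A hyperplane separates the point \<open>(x, f x)\<close> from the strict epigraph of
  \<open>f\<close>; it is not vertical, so it is the graph of an affine minorant touching
  \<open>f\<close> at \<open>x\<close>.\<close>

lemma convex_on_subgradient:
  fixes f :: "'b::euclidean_space \<Rightarrow> real"
  assumes f: "convex_on UNIV f"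
  shows "\<exists>y. \<forall>z. f x + y \<bullet> (z - x) \<le> f z"
proof -
  let ?E = "{p. f (fst p) < snd p}"
  have "convex ?E"
  proof (rule convexI)
    fix p q :: "'b \<times> real" and u v :: real
    assume pq: "p \<in> ?E" "q \<in> ?E" and uv: "0 \<le> u" "0 \<le> v" "u + v = 1"
    have "f (u *\<^sub>R fst p + v *\<^sub>R fst q) \<le> u * f (fst p) + v * f (fst q)"
      using f uv unfolding convex_on_def by blast
    also have "\<dots> < u * snd p + v * snd q"
    proof (cases "u = 0")
      case False
      then have "u * f (fst p) < u * snd p" using pq uv by simp
      moreover have "v * f (fst q) \<le> v * snd q" using pq uv by (intro mult_left_mono) auto
      ultimately show ?thesis by simp
    qed (use pq uv in auto)
    finally show "u *\<^sub>R p + v *\<^sub>R q \<in> ?E" by simp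
  qed
  moreover have "?E \<noteq> {}"
    by (auto intro!: exI[of _ x] exI[of _ "f x + 1"])
  moreover have "{(x, f x)} \<inter> ?E = {}" by simp
  ultimately have "\<exists>a b. a \<noteq> 0 \<and> (\<forall>p\<in>{(x, f x)}. inner a p \<le> b) \<and> (\<forall>p\<in>?E. inner a p \<ge> b)"
    by (intro separating_hyperplane_sets) auto
  then obtain a b where ab: "a \<noteq> 0" "inner a (x, f x) \<le> b" "\<And>p. p \<in> ?E \<Longrightarrow> inner a p \<ge> b"
    by auto
  obtain w \<alpha> where a: "a = (w, \<alpha>)" by (cases a)
  have le: "w \<bullet> x + \<alpha> * f x \<le> w \<bullet> z + \<alpha> * r" if "f z < r" for z r
    using ab(2) ab(3)[of "(z, r)"] that by (simp add: a)
  have "\<alpha> \<ge> 0" using le[of x "f x + 1"] by (simp add: algebra_simps)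
  \<comment> \<open>A vertical hyperplane would bound \<open>w \<bullet> z\<close> below by
    \<open>w \<bullet> x\<close> for every \<open>z\<close>, since \<open>f\<close> is finite
    everywhere; the choice \<open>z = x - w\<close> forces \<open>w = 0\<close>.\<close>
  moreover have "\<alpha> \<noteq> 0"
  proof
    assume "\<alpha> = 0"
    then have "w \<bullet> x \<le> w \<bullet> (x - w)" using le[of "x - w" "f (x - w) + 1"] by simp
    then have "w \<bullet> w \<le> 0" by (simp add: inner_diff_right)
    then have "w = 0" by (metis inner_eq_zero_iff inner_ge_zero order_antisym)
    then show False using ab(1) a \<open>\<alpha> = 0\<close> by (simp add: zero_prod_def)
  qed
  ultimately have \<alpha>: "\<alpha> > 0" by simp
  have "f x + (- (1 / \<alpha>) *\<^sub>R w) \<bullet> (z - x) \<le> f z" for z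
  proof (rule field_le_epsilon)
    fix e :: real assume "e > 0"
    then have "w \<bullet> x + \<alpha> * f x \<le> w \<bullet> z + \<alpha> * (f z + e)" using le by simp
    then have "\<alpha> * f x - w \<bullet> (z - x) \<le> \<alpha> * (f z + e)" by (simp add: inner_diff_right)
    then show "f x + (- (1 / \<alpha>) *\<^sub>R w) \<bullet> (z - x) \<le> f z + e"
      using \<alpha> by (simp add: field_simps)
  qed
  then show ?thesis by blast
qed

text \<open>The weights \<open>w t k\<close> are those of the first-order condition for a minimiser of the sum of the
  \<open>Z t ^ p\<close>. The proof combines \<open>ln x \<le> x - 1\<close> for \<open>M0\<close> with the nonnegativity of the relative
  entropy of the matrix \<open>w\<close> with respect to the product of its marginals.\<close>

lemma sum_power_le_card_of_log_concave:
  fixes M :: "'t \<Rightarrow> nat \<Rightarrow> real" and M0 :: "nat \<Rightarrow> real" and p :: nat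
  assumes fin: "finite T" "finite K" and p: "p \<ge> 1"
    and nonneg: "\<And>t k. M t k \<ge> 0"
    and Z: "\<And>t. t \<in> T \<Longrightarrow> Z t = (\<Sum>k\<in>K. M t k)" "\<And>t. t \<in> T \<Longrightarrow> Z t > 0"
    and M0: "(\<Sum>k\<in>K. M0 k) \<le> 1" "\<And>k. M0 k \<ge> 0"
    and w: "\<And>t k. w t k = Z t ^ (p - 1) * M t k"
    and le: "\<And>k. k \<in> K \<Longrightarrow> (\<Sum>t\<in>T. w t k) > 0 \<Longrightarrow>
      M0 k > 0 \<and> (\<Sum>t\<in>T. w t k * ln (M t k)) \<le> (\<Sum>t\<in>T. w t k) * ln (M0 k)"
  shows "(\<Sum>t\<in>T. Z t ^ p) \<le> card T"
proof (cases "T = {}")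
  case False
  define V where "V k = (\<Sum>t\<in>T. w t k)" for k
  define W where "W = (\<Sum>t\<in>T. Z t ^ p)"
  have W: "W > 0" unfolding W_def using fin False Z(2) by (intro sum_pos) auto
  have wn: "w t k \<ge> 0" if "t \<in> T" for t k
    unfolding w using nonneg Z(2)[OF that] by simp
  have Vn: "V k \<ge> 0" for k unfolding V_def using wn by (intro sum_nonneg) auto
  have row: "(\<Sum>k\<in>K. w t k) = Z t ^ p" if "t \<in> T" for t
    using p Z(1)[OF that] by (simp add: w sum_distrib_left[symmetric] power_eq_if)
  have WV: "(\<Sum>k\<in>K. V k) = W"
    unfolding V_def W_def by (subst sum.swap) (simp add: row)
  \<comment> \<open>This is \<open>ln x \<le> x - 1\<close> at \<open>x = M0 k * W / V k\<close>. In
    the sum over \<open>K\<close> the terms \<open>V k\<close> add up to \<open>W\<close>, which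
    absorbs the right-hand side.\<close>
  have step1: "V k + V k * (ln (M0 k) + ln W - ln (V k)) \<le> W * M0 k" if "k \<in> K" for k
  proof (cases "V k = 0")
    case False
    then have V: "V k > 0" using Vn[of k] by simp
    then have m: "M0 k > 0" using le[OF that] unfolding V_def by simp
    have "ln (M0 k * W / V k) \<le> M0 k * W / V k - 1"
      using V m W by (intro ln_le_minus_one) simp
    then have "1 + (ln (M0 k) + ln W - ln (V k)) \<le> M0 k * W / V k"
      using V m W by (simp add: ln_mult ln_div)
    then have "V k * (1 + (ln (M0 k) + ln W - ln (V k))) \<le> V k * (M0 k * W / V k)"
      using V by (intro mult_left_mono) auto
    then show ?thesis using V by (simp add: algebra_simps)
  qed (use W M0 in auto)
  have "W + (\<Sum>k\<in>K. V k * (ln (M0 k) + ln W - ln (V k))) \<le> W * (\<Sum>k\<in>K. M0 k)"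
    using sum_mono[of K "\<lambda>k. V k + V k * (ln (M0 k) + ln W - ln (V k))" "\<lambda>k. W * M0 k", OF step1]
    by (simp add: sum.distrib WV sum_distrib_left)
  also have "\<dots> \<le> W * 1" using W M0 by (intro mult_left_mono) auto
  finally have "(\<Sum>k\<in>K. V k * (ln (M0 k) + ln W - ln (V k))) \<le> 0" by simp
  moreover have "(\<Sum>t\<in>T. w t k * (ln (M t k) + ln W - ln (V k))) \<le> V k * (ln (M0 k) + ln W - ln (V k))"
    if "k \<in> K" for k
  proof (cases "V k = 0")
    case True
    then have "\<forall>t\<in>T. w t k = 0" unfolding V_def using wn fin by (simp add: sum_nonneg_eq_0_iff)
    then show ?thesis using True by simp
  next
    case False
    then have "V k > 0" using Vn[of k] by simp
    then have "(\<Sum>t\<in>T. w t k * ln (M t k)) \<le> V k * ln (M0 k)"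
      using le[OF that] unfolding V_def by simp
    then have "(\<Sum>t\<in>T. w t k * ln (M t k)) + V k * (ln W - ln (V k)) \<le> V k * (ln (M0 k) + ln W - ln (V k))"
      by (simp add: algebra_simps)
    also have "V k * (ln W - ln (V k)) = (\<Sum>t\<in>T. w t k * (ln W - ln (V k)))"
      unfolding V_def by (simp add: sum_distrib_right)
    finally show ?thesis by (simp add: sum.distrib[symmetric] algebra_simps)
  qed
  ultimately have le0: "(\<Sum>k\<in>K. \<Sum>t\<in>T. w t k * (ln (M t k) + ln W - ln (V k))) \<le> 0"
    by (meson order_trans sum_mono)
  \<comment> \<open>\<open>V k * Z t ^ p / W\<close> is the product of the column and row sums of
    \<open>w\<close> over its total mass. By the definition of \<open>w\<close>,
    \<open>ln (M t k) + ln W - ln (V k)\<close> is \<open>ln (Z t)\<close> plus the logarithm of the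
    ratio of \<open>w t k\<close> to this product, and \<open>ln x \<le> x - 1\<close> for the
    inverse ratio bounds that logarithm from below.\<close>
  have "w t k * ln (Z t) + (w t k - V k * Z t ^ p / W) \<le> w t k * (ln (M t k) + ln W - ln (V k))"
    if t: "t \<in> T" and k: "k \<in> K" for t k
  proof (cases "w t k = 0")
    case True
    then show ?thesis using Vn[of k] W Z(2)[OF t] by simp
  next
    case False
    then have pos: "w t k > 0" using wn[OF t, of k] by simp
    then have m: "M t k > 0" using nonneg[of t k] unfolding w by (cases "M t k = 0") auto
    have z: "Z t > 0" using Z(2)[OF t] .
    have V: "V k > 0"
      unfolding V_def using fin t pos wn by (intro sum_pos2[of _ t]) auto
    let ?x = "V k * Z t ^ p / W"
    have "ln (?x / w t k) \<le> ?x / w t k - 1"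
      using V z W pos by (intro ln_le_minus_one) simp
    moreover have "ln (?x / w t k) = ln (V k) + p * ln (Z t) - ln W - ln (w t k)"
      using V z W pos by (simp add: ln_mult ln_div ln_realpow)
    moreover have "ln (w t k) = (p - 1) * ln (Z t) + ln (M t k)"
      unfolding w using z m by (simp add: ln_mult ln_realpow)
    moreover have "real p * ln (Z t) = (p - 1) * ln (Z t) + ln (Z t)"
      using p by (simp add: of_nat_diff algebra_simps)
    ultimately have "ln (Z t) + (1 - ?x / w t k) \<le> ln (M t k) + ln W - ln (V k)" by linarith
    then have "w t k * (ln (Z t) + (1 - ?x / w t k)) \<le> w t k * (ln (M t k) + ln W - ln (V k))"
      using pos by (intro mult_left_mono) auto
    moreover have "w t k * (ln (Z t) + (1 - ?x / w t k)) = w t k * ln (Z t) + (w t k - ?x)"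
      using pos by (simp add: distrib_left right_diff_distrib del: times_divide_eq_right) simp
    ultimately show ?thesis by simp
  qed
  then have "(\<Sum>k\<in>K. \<Sum>t\<in>T. w t k * ln (Z t) + (w t k - V k * Z t ^ p / W)) \<le> 0"
    by (intro order_trans[OF sum_mono[OF sum_mono] le0])
  \<comment> \<open>Both \<open>w\<close> and the normalised product of its marginals have total
    mass \<open>W\<close>, so the correction terms cancel.\<close>
  moreover have "(\<Sum>k\<in>K. \<Sum>t\<in>T. w t k * ln (Z t) + (w t k - V k * Z t ^ p / W)) = (\<Sum>t\<in>T. Z t ^ p * ln (Z t))"
  proof -
    have "(\<Sum>k\<in>K. \<Sum>t\<in>T. w t k * ln (Z t)) = (\<Sum>t\<in>T. Z t ^ p * ln (Z t))"
      by (subst sum.swap) (simp add: row flip: sum_distrib_right)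
    moreover have "(\<Sum>k\<in>K. \<Sum>t\<in>T. w t k) = W" by (simp add: WV V_def[symmetric])
    moreover have "(\<Sum>k\<in>K. \<Sum>t\<in>T. V k * Z t ^ p / W) = W"
      using W by (simp add: sum_divide_distrib[symmetric] sum_distrib_left[symmetric] sum_distrib_right[symmetric] WV W_def[symmetric])
    ultimately show ?thesis by (simp add: sum.distrib sum_subtractf)
  qed
  ultimately have "(\<Sum>t\<in>T. Z t ^ p * ln (Z t)) \<le> 0" by simp
  then have "real p * (\<Sum>t\<in>T. Z t ^ p * ln (Z t)) \<le> 0" by (simp add: mult_nonneg_nonpos)
  \<comment> \<open>This is \<open>x - 1 \<le> x * ln x\<close> at \<open>x = Z t ^ p\<close>; it
    turns the entropy bound into a bound on the sum of powers.\<close>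
  moreover have "(\<Sum>t\<in>T. Z t ^ p - 1) \<le> real p * (\<Sum>t\<in>T. Z t ^ p * ln (Z t))"
    unfolding sum_distrib_left
  proof (rule sum_mono)
    fix t assume t: "t \<in> T"
    have z: "Z t > 0" using Z(2)[OF t] .
    have "1 - inverse (Z t ^ p) \<le> ln (Z t ^ p)"
      using ln_le_minus_one[of "inverse (Z t ^ p)"] z by (simp add: ln_inverse)
    then have "Z t ^ p * (1 - inverse (Z t ^ p)) \<le> Z t ^ p * ln (Z t ^ p)"
      using z by (intro mult_left_mono) auto
    then show "Z t ^ p - 1 \<le> real p * (Z t ^ p * ln (Z t))"
      using z by (simp add: ln_realpow right_diff_distrib mult.left_commute)
  qed
  ultimately show ?thesis by (simp add: sum_subtractf)
qed simp

lemma not_AE_lborel_False: "\<not> (AE x in (lborel :: 'b::euclidean_space measure). False)"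
  using emeasure_eq_0_AE[of "\<lambda>_. True" "lborel :: 'b measure"] by (auto simp: emeasure_lborel_UNIV)

lemma integral_lborel_pos:
  fixes f :: "'b::euclidean_space \<Rightarrow> real"
  assumes f: "integrable lborel f" and pos: "\<And>x. 0 < f x"
  shows "0 < (\<integral>x. f x \<partial>lborel)"
proof (rule ccontr)
  assume "\<not> ?thesis"
  moreover have "0 \<le> (\<integral>x. f x \<partial>lborel)" using pos by (intro Bochner_Integration.integral_nonneg) (auto intro: less_imp_le)
  ultimately have "(\<integral>x. f x \<partial>lborel) = 0" by simp
  then have "AE x in lborel. f x = 0"
    using f pos by (subst (asm) integral_nonneg_eq_0_iff_AE) (auto intro: less_imp_le)
  then have "AE x in (lborel :: 'b measure). False"
    by eventually_elim (metis pos less_irrefl)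
  then show False by (simp add: not_AE_lborel_False)
qed

section \<open>Extensions of finite maxima of affine functions\<close>

locale affine_family =
  fixes \<phi> :: "'a::euclidean_space \<times> 'b::euclidean_space \<Rightarrow> real"
    and y :: "nat \<Rightarrow> 'b" and c :: "nat \<Rightarrow> real"
  assumes convex_phi: "convex_on UNIV \<phi>"
    and finite_at_0: "\<And>k. (\<integral>\<^sup>+x. ennreal (exp (y k \<bullet> x + c k - \<phi> (0, x))) \<partial>lborel) < \<infinity>"
begin

definition tilt :: "(nat \<Rightarrow> 'a) \<Rightarrow> nat \<Rightarrow> 'a \<Rightarrow> 'b \<Rightarrow> real" where
  "tilt s k t x = exp (y k \<bullet> x + c k + s k \<bullet> t - \<phi> (t, x))"

text \<open>The element \<open>0\<close> only matters for \<open>K = {}\<close>, where it replaces the unspecified \<open>Max {}\<close>.\<close>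

definition envelope :: "(nat \<Rightarrow> 'a) \<Rightarrow> nat set \<Rightarrow> 'a \<Rightarrow> 'b \<Rightarrow> real" where
  "envelope s K t x = Max (insert 0 ((\<lambda>k. tilt s k t x) ` K))"

definition Z :: "(nat \<Rightarrow> 'a) \<Rightarrow> nat set \<Rightarrow> 'a \<Rightarrow> real" where
  "Z s K t = (\<integral>x. envelope s K t x \<partial>lborel)"

text \<open>The strict inequality makes the cells of distinct indices in \<open>K\<close> disjoint;
  points where the maximum is tied lie in none of them.\<close>

definition cell :: "(nat \<Rightarrow> 'a) \<Rightarrow> nat set \<Rightarrow> nat \<Rightarrow> 'a \<Rightarrow> 'b \<Rightarrow> real" where
  "cell s K k t x = indicator {x. envelope s (K - {k}) t x < tilt s k t x} x * tilt s k t x"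

definition M :: "(nat \<Rightarrow> 'a) \<Rightarrow> nat set \<Rightarrow> nat \<Rightarrow> 'a \<Rightarrow> real" where
  "M s K k t = (\<integral>x. cell s K k t x \<partial>lborel)"

section \<open>Regularity and integrability of the functions \<open>tilt\<close>\<close>

lemma tilt_pos: "0 < tilt s k t x"
  by (simp add: tilt_def)

lemma continuous_phi: "continuous_on UNIV \<phi>"
  by (rule convex_on_continuous[OF open_UNIV convex_phi])

lemma continuous_tilt: "continuous_on UNIV (\<lambda>(t, x). tilt s k t x)"
proof -
  have "continuous_on UNIV (\<lambda>z. exp (y k \<bullet> snd z + c k + s k \<bullet> fst z - \<phi> z))"
    using continuous_phi by (intro continuous_intros) auto
  then show ?thesis by (simp add: tilt_def case_prod_beta')
qed

lemma measurable_tilt[measurable]: "tilt s k t \<in> borel_measurable borel"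
proof -
  have "continuous_on UNIV ((\<lambda>(t, x). tilt s k t x) \<circ> Pair t)"
    by (intro continuous_on_compose continuous_on_subset[OF continuous_tilt] continuous_intros) auto
  then show ?thesis by (intro borel_measurable_continuous_onI) (simp add: comp_def)
qed

lemma concave_exponent: "concave_on UNIV (\<lambda>z. y k \<bullet> snd z + c k + s k \<bullet> fst z - \<phi> z)"
  unfolding concave_on_def
proof (rule convex_onI)
  fix l :: real and p q :: "'a \<times> 'b" assume l: "0 < l" "l < 1"
  have "\<phi> ((1 - l) *\<^sub>R p + l *\<^sub>R q) \<le> (1 - l) * \<phi> p + l * \<phi> q"
    using convex_onD[OF convex_phi, of l p q] l by simp
  then show "- (y k \<bullet> snd ((1 - l) *\<^sub>R p + l *\<^sub>R q) + c k + s k \<bullet> fst ((1 - l) *\<^sub>R p + l *\<^sub>R q) - \<phi> ((1 - l) *\<^sub>R p + l *\<^sub>R q))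
     \<le> (1 - l) * - (y k \<bullet> snd p + c k + s k \<bullet> fst p - \<phi> p) + l * - (y k \<bullet> snd q + c k + s k \<bullet> fst q - \<phi> q)"
    by (simp add: inner_add_right algebra_simps)
qed simp

text \<open>Finiteness spreads from \<open>0\<close> to every \<open>t\<close> by log-concavity of
  the mass \<open>?N\<close>: an infinite value at \<open>t\<close> and the positive value at
  \<open>- t\<close> would make the value at the midpoint \<open>0\<close> infinite.\<close>

lemma integrable_tilt: "integrable lborel (tilt s k t)"
proof -
  let ?N = "\<lambda>t. \<integral>\<^sup>+x. ennreal (tilt (\<lambda>_. 0) k t x) \<partial>lborel"
  have "geo_le (1/2) (?N t) (?N (- t)) (?N ((1 - 1/2) *\<^sub>R t + (1/2) *\<^sub>R (- t)))"
    using marginal_log_concave[OF concave_exponent[of k "\<lambda>_. 0"] convex_UNIV, of "1/2" t "- t"]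
    by (simp add: tilt_def)
  then have geo: "geo_le (1/2) (?N t) (?N (- t)) (?N 0)" by simp
  have "?N 0 < \<infinity>" using finite_at_0[of k] by (simp add: tilt_def)
  then obtain r where r: "?N 0 = ennreal r" "r \<ge> 0" by (cases "?N 0") auto
  have "?N (- t) \<noteq> 0"
  proof
    assume "?N (- t) = 0"
    then have "AE x in lborel. ennreal (tilt (\<lambda>_. 0) k (- t) x) = 0"
      by (subst (asm) nn_integral_0_iff_AE) auto
    then have "AE x in (lborel :: 'b measure). False"
      by eventually_elim (metis ennreal_eq_0_iff tilt_pos not_le)
    then show False by (simp add: not_AE_lborel_False)
  qed
  then obtain b where b: "b > 0" "ennreal b \<le> ?N (- t)"
  proof (cases "?N (- t)")
    case (real b)
    with \<open>?N (- t) \<noteq> 0\<close> show ?thesis by (intro that[of b]) auto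
  qed (intro that[of 1], auto)
  have "?N t \<noteq> \<infinity>"
  proof
    assume inf: "?N t = \<infinity>"
    \<comment> \<open>Chosen so that the geometric mean of \<open>a\<close> and \<open>b\<close> is
      \<open>r + 1\<close>, which exceeds the mass \<open>r\<close> at \<open>0\<close>.\<close>
    define a where "a = (r + 1)\<^sup>2 / b"
    have a: "a > 0" using r b by (simp add: a_def)
    have "ennreal (a powr (1 - 1/2) * b powr (1/2)) \<le> ?N 0"
      using a b inf by (intro geo_leD[OF geo]) auto
    moreover have "a powr (1 - 1/2) * b powr (1/2) = r + 1"
      using a b r by (simp add: powr_half_sqrt flip: real_sqrt_mult) (simp add: a_def)
    ultimately show False using r by simp
  qed
  then have "integrable lborel (tilt (\<lambda>_. 0) k t)"
    by (intro integrableI_nonneg) (auto simp: less_top less_imp_le[OF tilt_pos])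
  \<comment> \<open>The slope \<open>s k\<close> contributes only a factor that is constant in
    \<open>x\<close>.\<close>
  moreover have "tilt s k t = (\<lambda>x. exp (s k \<bullet> t) * tilt (\<lambda>_. 0) k t x)"
    by (simp add: tilt_def fun_eq_iff exp_add[symmetric] algebra_simps)
  ultimately show ?thesis by simp
qed

section \<open>Elementary properties of finite envelopes\<close>

lemma envelope_empty[simp]: "envelope s {} t x = 0"
  by (simp add: envelope_def)

lemma envelope_insert: "finite K \<Longrightarrow> envelope s (insert k K) t x = max (tilt s k t x) (envelope s K t x)"
  unfolding envelope_def by (subst image_insert, subst insert_commute, subst Max_insert) auto

lemma envelope_remove: "finite K \<Longrightarrow> k \<in> K \<Longrightarrow> envelope s K t x = max (tilt s k t x) (envelope s (K - {k}) t x)"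
  by (metis envelope_insert finite_Diff insert_Diff)

lemma envelope_cong: "(\<And>k. k \<in> K \<Longrightarrow> s k = s' k) \<Longrightarrow> envelope s K t x = envelope s' K t x"
  unfolding envelope_def tilt_def by (metis (mono_tags, lifting) image_cong)

lemma envelope_nonneg: "finite K \<Longrightarrow> 0 \<le> envelope s K t x"
  unfolding envelope_def by simp

lemma tilt_le_envelope: "finite K \<Longrightarrow> k \<in> K \<Longrightarrow> tilt s k t x \<le> envelope s K t x"
  unfolding envelope_def by simp

lemma envelope_less_iff: "finite K \<Longrightarrow> envelope s K t x < tilt s k t x \<longleftrightarrow> (\<forall>j\<in>K. tilt s j t x < tilt s k t x)"
  unfolding envelope_def by (subst Max_less_iff) (auto simp: tilt_pos)

lemma envelope_le_sum: "finite K \<Longrightarrow> envelope s K t x \<le> (\<Sum>k\<in>K. tilt s k t x)"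
proof (induction K rule: finite_induct)
  case (insert k K)
  have "0 \<le> (\<Sum>k\<in>K. tilt s k t x)" by (intro sum_nonneg less_imp_le[OF tilt_pos])
  then show ?case using insert less_imp_le[OF tilt_pos[of s k t x]] by (simp add: envelope_insert)
qed simp

lemma envelope_mono: "finite L \<Longrightarrow> K \<subseteq> L \<Longrightarrow> envelope s K t x \<le> envelope s L t x"
  unfolding envelope_def by (intro Max_mono) auto

lemma integrable_envelope: "finite K \<Longrightarrow> integrable lborel (envelope s K t)"
proof (induction K rule: finite_induct)
  case (insert k K)
  then have "envelope s (insert k K) t = (\<lambda>x. max (tilt s k t x) (envelope s K t x))"
    by (simp add: envelope_insert fun_eq_iff)
  then show ?case using insert.IH integrable_tilt by simp
next
  case empty
  have "envelope s {} t = (\<lambda>x. 0)" by (simp add: fun_eq_iff)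
  then show ?case by simp
qed

lemma measurable_envelope: "finite K \<Longrightarrow> envelope s K t \<in> borel_measurable borel"
  using borel_measurable_integrable[OF integrable_envelope] by simp

section \<open>Cells, their log-concave masses and the derivative of \<open>Z\<close>\<close>

lemma integrable_cell:
  assumes "finite K" shows "integrable lborel (cell s K k t)"
proof -
  have [measurable]: "envelope s (K - {k}) t \<in> borel_measurable borel"
    using assms by (intro measurable_envelope) auto
  have "{x. envelope s (K - {k}) t x < tilt s k t x} \<in> sets lborel" by measurable
  then have "integrable lborel (\<lambda>x. indicator {x. envelope s (K - {k}) t x < tilt s k t x} x *\<^sub>R tilt s k t x)"
    by (intro integrable_mult_indicator integrable_tilt)
  then show ?thesis unfolding cell_def by simp
qed

text \<open>A tie between \<open>j\<close> and \<open>k\<close> confines \<open>x\<close> to a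
  hyperplane with normal \<open>y j - y k\<close>, which is nonzero because the slopes in
  \<open>K\<close> are distinct.\<close>

lemma AE_no_ties:
  assumes "finite K" "inj_on y K"
  shows "AE x in lborel. \<forall>j\<in>K. \<forall>k\<in>K. j \<noteq> k \<longrightarrow> tilt s j t x \<noteq> tilt s k t x"
proof -
  have "AE x in lborel. j \<noteq> k \<longrightarrow> tilt s j t x \<noteq> tilt s k t x" if "j \<in> K" "k \<in> K" for j k
  proof (cases "j = k")
    case False
    then have ne: "y j - y k \<noteq> 0" using assms(2) that by (auto dest: inj_onD)
    let ?H = "{x. (y j - y k) \<bullet> x = (c k + s k \<bullet> t) - (c j + s j \<bullet> t)}"
    have "negligible ?H" using ne by (intro negligible_hyperplane) auto
    moreover have "closed ?H" by (rule closed_hyperplane)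
    ultimately have "?H \<in> null_sets lborel"
      by (simp add: negligible_iff_null_sets null_sets_completion_iff)
    then have "AE x in lborel. x \<notin> ?H" by (rule AE_not_in)
    then show ?thesis
      by eventually_elim (auto simp: tilt_def inner_diff_left)
  qed simp
  then show ?thesis
    using assms(1) by (intro AE_ball_countable[THEN iffD2] countable_finite ballI)
qed

text \<open>Without ties exactly one index attains the maximum, and only its cell contributes to the
  sum.\<close>

lemma envelope_eq_sum_cell:
  assumes K: "finite K" and ne: "\<forall>j\<in>K. \<forall>k\<in>K. j \<noteq> k \<longrightarrow> tilt s j t x \<noteq> tilt s k t x"
  shows "envelope s K t x = (\<Sum>k\<in>K. cell s K k t x)"
proof (cases "K = {}")
  case False
  then have "Max ((\<lambda>k. tilt s k t x) ` K) \<in> (\<lambda>k. tilt s k t x) ` K" using K by (intro Max_in) auto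
  then obtain k where k: "k \<in> K" "Max ((\<lambda>k. tilt s k t x) ` K) = tilt s k t x" by blast
  then have k: "k \<in> K" "\<And>j. j \<in> K \<Longrightarrow> tilt s j t x \<le> tilt s k t x"
    using K by (auto simp flip: k(2))
  have less: "tilt s j t x < tilt s k t x" if "j \<in> K - {k}" for j
    using k ne that by (auto simp: less_le)
  then have le: "envelope s (K - {k}) t x < tilt s k t x"
    using K by (subst envelope_less_iff) auto
  have "cell s K j t x = (if j = k then tilt s k t x else 0)" if "j \<in> K" for j
  proof (cases "j = k")
    case False
    then have "tilt s k t x \<le> envelope s (K - {j}) t x"
      using K k by (intro tilt_le_envelope) auto
    moreover have "tilt s j t x < tilt s k t x" using less that False by simp
    ultimately have "\<not> envelope s (K - {j}) t x < tilt s j t x" by linarith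
    then show ?thesis using False by (simp add: cell_def)
  qed (use le in \<open>simp add: cell_def\<close>)
  then have "(\<Sum>k\<in>K. cell s K k t x) = tilt s k t x"
    using K k(1) by (simp add: sum.delta cong: sum.cong)
  moreover have "envelope s K t x = tilt s k t x"
    using le by (subst envelope_remove[OF K k(1)]) simp
  ultimately show ?thesis by simp
qed simp

lemma Z_eq_sum_M:
  assumes "finite K" "inj_on y K"
  shows "Z s K t = (\<Sum>k\<in>K. M s K k t)"
proof -
  have "Z s K t = (\<integral>x. (\<Sum>k\<in>K. cell s K k t x) \<partial>lborel)"
    unfolding Z_def
  proof (rule integral_cong_AE)
    show "AE x in lborel. envelope s K t x = (\<Sum>k\<in>K. cell s K k t x)"
      using AE_no_ties[OF assms] by eventually_elim (rule envelope_eq_sum_cell[OF assms(1)])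
  qed (use assms in \<open>auto intro!: measurable_envelope borel_measurable_sum borel_measurable_integrable[OF integrable_cell, simplified]\<close>)
  also have "\<dots> = (\<Sum>k\<in>K. M s K k t)"
    unfolding M_def using assms by (intro Bochner_Integration.integral_sum integrable_cell)
  finally show ?thesis .
qed

lemma cell_nonneg: "0 \<le> cell s K k t x"
  by (simp add: cell_def less_imp_le[OF tilt_pos])

lemma M_nonneg: "0 \<le> M s K k t"
  unfolding M_def by (intro Bochner_Integration.integral_nonneg cell_nonneg)

text \<open>Comparing two tilts cancels \<open>\<phi>\<close>, so the pairs \<open>(t, x)\<close> in
  the cell of \<open>k\<close> form a finite intersection of open half-spaces \<open>?S\<close>.
  This convex set and the concave exponent of the \<open>k\<close>-th tilt are the data for
  \<open>marginal_log_concave\<close>.\<close>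

lemma M_log_concave:
  assumes K: "finite K" and l: "0 < l" "l < 1" and pos: "0 < M s K k t" "0 < M s K k t'"
  shows "M s K k t powr (1 - l) * M s K k t' powr l \<le> M s K k ((1 - l) *\<^sub>R t + l *\<^sub>R t')"
proof -
  let ?u = "\<lambda>k z. y k \<bullet> snd z + c k + s k \<bullet> fst z - \<phi> z"
  let ?S = "\<Inter>j\<in>K - {k}. {z. ((s j, y j) - (s k, y k)) \<bullet> z < c k - c j}"
  have S: "convex ?S" by (intro convex_INT convex_halfspace_lt)
  have "open ?S" using K by (intro open_INT ballI open_halfspace_lt) auto
  then have Sb: "?S \<in> sets borel" by simp
  have cell: "cell s K k t x = indicator ?S (t, x) * exp (?u k (t, x))" for t x
  proof -
    have "envelope s (K - {k}) t x < tilt s k t x \<longleftrightarrow> (t, x) \<in> ?S"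
      using K by (subst envelope_less_iff) (auto simp: tilt_def inner_diff_left algebra_simps)
    then show ?thesis by (simp add: cell_def tilt_def split: split_indicator)
  qed
  have nn: "(\<integral>\<^sup>+x. ennreal (indicator ?S (t, x) * exp (?u k (t, x))) \<partial>lborel) = ennreal (M s K k t)" for t
    unfolding M_def cell[symmetric]
    by (intro nn_integral_eq_integral integrable_cell K AE_I2 cell_nonneg)
  have "geo_le l (ennreal (M s K k t)) (ennreal (M s K k t')) (ennreal (M s K k ((1 - l) *\<^sub>R t + l *\<^sub>R t')))"
    unfolding nn[symmetric] by (rule marginal_log_concave[OF concave_exponent S Sb l])
  then have "ennreal (M s K k t powr (1 - l) * M s K k t' powr l) \<le> ennreal (M s K k ((1 - l) *\<^sub>R t + l *\<^sub>R t'))"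
    using pos by (intro geo_leD[where l=l]) auto
  then show ?thesis by (simp add: M_nonneg)
qed

text \<open>The domain is restricted to positive masses because \<open>ln 0\<close> has a default
  value. That this domain is convex follows from the same log-concavity inequality.\<close>

lemma convex_on_neg_ln_M:
  assumes K: "finite K"
  shows "convex_on {t. 0 < M s K k t} (\<lambda>t. - ln (M s K k t))"
proof (rule convex_onI)
  have mid: "0 < M s K k ((1 - l) *\<^sub>R t + l *\<^sub>R t')"
      "- ln (M s K k ((1 - l) *\<^sub>R t + l *\<^sub>R t')) \<le> (1 - l) * - ln (M s K k t) + l * - ln (M s K k t')"
    if l: "0 < l" "l < 1" and pos: "0 < M s K k t" "0 < M s K k t'" for l t t'
  proof -
    have le: "M s K k t powr (1 - l) * M s K k t' powr l \<le> M s K k ((1 - l) *\<^sub>R t + l *\<^sub>R t')"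
      by (rule M_log_concave[OF K l pos])
    have p: "0 < M s K k t powr (1 - l) * M s K k t' powr l" using pos by simp
    show 1: "0 < M s K k ((1 - l) *\<^sub>R t + l *\<^sub>R t')" using le p by linarith
    have "ln (M s K k t powr (1 - l) * M s K k t' powr l) \<le> ln (M s K k ((1 - l) *\<^sub>R t + l *\<^sub>R t'))"
      using le p 1 by (subst ln_le_cancel_iff) auto
    then show "- ln (M s K k ((1 - l) *\<^sub>R t + l *\<^sub>R t')) \<le> (1 - l) * - ln (M s K k t) + l * - ln (M s K k t')"
      using pos by (simp add: ln_mult ln_powr)
  qed
  show "convex {t. 0 < M s K k t}"
    unfolding convex_alt
  proof (intro ballI allI impI)
    fix t t' and u :: real
    assume "t \<in> {t. 0 < M s K k t}" "t' \<in> {t. 0 < M s K k t}" "0 \<le> u \<and> u \<le> 1"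
    then show "(1 - u) *\<^sub>R t + u *\<^sub>R t' \<in> {t. 0 < M s K k t}"
      using mid(1)[of u t t'] by (cases "u = 0"; cases "u = 1") auto
  qed
  show "- ln (M s K k ((1 - l) *\<^sub>R t + l *\<^sub>R t')) \<le> (1 - l) * - ln (M s K k t) + l * - ln (M s K k t')"
    if "0 < l" "l < 1" "t \<in> {t. 0 < M s K k t}" "t' \<in> {t. 0 < M s K k t}" for l t t'
    using mid(2) that by simp
qed

text \<open>Moving one slope rescales one tilt by \<open>exp (\<epsilon> * (v \<bullet> t))\<close>
  and leaves the envelope of the others fixed, which is the situation of
  \<open>has_derivative_integral_max\<close>.\<close>

lemma has_derivative_Z:
  assumes K: "finite K" "inj_on y K" "k \<in> K"
  shows "((\<lambda>\<epsilon>. Z (s(k := s k + \<epsilon> *\<^sub>R v)) K t) has_real_derivative (v \<bullet> t) * M s K k t) (at 0)"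
proof -
  have "envelope (s(k := s k + \<epsilon> *\<^sub>R v)) K t x = max (exp (\<epsilon> * (v \<bullet> t)) * tilt s k t x) (envelope s (K - {k}) t x)" for \<epsilon> x
  proof -
    have "envelope (s(k := s k + \<epsilon> *\<^sub>R v)) (K - {k}) t x = envelope s (K - {k}) t x"
      by (rule envelope_cong) auto
    moreover have "tilt (s(k := s k + \<epsilon> *\<^sub>R v)) k t x = exp (\<epsilon> * (v \<bullet> t)) * tilt s k t x"
      by (simp add: tilt_def exp_add[symmetric] inner_add_left algebra_simps)
    ultimately show ?thesis by (simp add: envelope_remove[OF K(1,3)])
  qed
  then have Z: "Z (s(k := s k + \<epsilon> *\<^sub>R v)) K t =
      (\<integral>x. max (exp (\<epsilon> * (v \<bullet> t)) * tilt s k t x) (envelope s (K - {k}) t x) \<partial>lborel)" for \<epsilon>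
    by (simp add: Z_def)
  have ne: "AE x in lborel. tilt s k t x \<noteq> envelope s (K - {k}) t x"
    using AE_no_ties[OF K(1,2), of s t]
  proof eventually_elim
    case (elim x)
    \<comment> \<open>The maximum is either the default 0, excluded because tilts are positive, or
      another tilt, excluded because there are no ties.\<close>
    have *: "envelope s (K - {k}) t x \<in> insert 0 ((\<lambda>k. tilt s k t x) ` (K - {k}))"
      unfolding envelope_def using K by (intro Max_in) auto
    show ?case
    proof
      assume eq: "tilt s k t x = envelope s (K - {k}) t x"
      have "tilt s k t x \<in> (\<lambda>k. tilt s k t x) ` (K - {k})"
        using *[folded eq] tilt_pos[of s k t x] by (auto simp del: insert_Diff_single)
      then obtain j where "j \<in> K - {k}" "tilt s k t x = tilt s j t x" ..
      then show False using elim[rule_format, of j k] K(3) by simp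
    qed
  qed
  have "finite (K - {k})" using K by simp
  note D = has_derivative_integral_max[OF integrable_tilt integrable_envelope[OF this] tilt_pos ne, of "v \<bullet> t"]
  have M: "M s K k t = (\<integral>x. indicator {x. envelope s (K - {k}) t x < tilt s k t x} x * tilt s k t x \<partial>lborel)"
    by (simp only: M_def cell_def)
  show ?thesis unfolding Z M by (rule D)
qed

section \<open>Continuity and coercivity in the slopes\<close>

lemma envelope_tendsto:
  assumes "finite K" "\<And>k. k \<in> K \<Longrightarrow> (\<lambda>n. S n k) \<longlonglongrightarrow> s k"
  shows "(\<lambda>n. envelope (S n) K t x) \<longlonglongrightarrow> envelope s K t x"
  using assms
proof (induction K rule: finite_induct)
  case (insert k K)
  have "(\<lambda>n. tilt (S n) k t x) \<longlonglongrightarrow> tilt s k t x"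
    unfolding tilt_def using insert.prems[of k] by (intro tendsto_intros) auto
  then show ?case
    using insert by (simp add: envelope_insert tendsto_max)
qed simp

text \<open>Convergent slopes are bounded, so all the envelopes lie below one finite sum of
  integrable tilts, and dominated convergence applies.\<close>

lemma Z_tendsto:
  assumes K: "finite K" and S: "\<And>k. k \<in> K \<Longrightarrow> (\<lambda>n. S n k) \<longlonglongrightarrow> s k"
  shows "(\<lambda>n. Z (S n) K t) \<longlonglongrightarrow> Z s K t"
proof -
  have "\<exists>B. \<forall>n. norm (S n k) \<le> B" if "k \<in> K" for k
    using convergent_imp_Bseq[OF convergentI[OF S[OF that]]] by (auto simp: Bseq_def)
  then obtain B where B: "\<And>k n. k \<in> K \<Longrightarrow> norm (S n k) \<le> B k" by metis
  show ?thesis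
    unfolding Z_def
  proof (rule integral_dominated_convergence)
    show "integrable lborel (\<lambda>x. \<Sum>k\<in>K. exp (B k * norm t) * tilt (\<lambda>_. 0) k t x)"
      by (intro Bochner_Integration.integrable_sum integrable_mult_right integrable_tilt)
    fix n
    have "envelope (S n) K t x \<le> (\<Sum>k\<in>K. exp (B k * norm t) * tilt (\<lambda>_. 0) k t x)" for x
    proof (rule order_trans[OF envelope_le_sum[OF K] sum_mono])
      fix k assume k: "k \<in> K"
      have "S n k \<bullet> t \<le> norm (S n k) * norm t" by (rule norm_cauchy_schwarz)
      also have "\<dots> \<le> B k * norm t" using B[OF k] by (intro mult_right_mono) auto
      finally show "tilt (S n) k t x \<le> exp (B k * norm t) * tilt (\<lambda>_. 0) k t x"
        by (simp add: tilt_def flip: exp_add)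
    qed
    then show "AE x in lborel. norm (envelope (S n) K t x) \<le> (\<Sum>k\<in>K. exp (B k * norm t) * tilt (\<lambda>_. 0) k t x)"
      using envelope_nonneg[OF K] by simp
  qed (use K in \<open>auto intro!: measurable_envelope envelope_tendsto S\<close>)
qed

text \<open>Each term comes from solving \<open>exp (s k \<bullet> t) * I \<le> C\<close> for
  \<open>s k \<bullet> t\<close>, where \<open>I\<close> is the mass of the piece with zero slope in
  \<open>t\<close>. The bound does not involve \<open>K\<close>, so it is uniform over growing index
  sets.\<close>

definition slope_bound :: "real \<Rightarrow> nat \<Rightarrow> real" where
  "slope_bound C k = (\<Sum>b\<in>Basis. \<bar>ln (C / (\<integral>x. tilt (\<lambda>_. 0) k b x \<partial>lborel))\<bar> + \<bar>ln (C / (\<integral>x. tilt (\<lambda>_. 0) k (- b) x \<partial>lborel))\<bar>)"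

text \<open>The masses at \<open>\<plusminus>b\<close>, \<open>b \<in> Basis\<close>, already control the slopes: this gives coercivity of the
  minimisation problem and compactness in the final limit.\<close>

lemma norm_le_slope_bound:
  assumes K: "finite K" "k \<in> K" and C: "\<And>b. b \<in> Basis \<Longrightarrow> Z s K b \<le> C" "\<And>b. b \<in> Basis \<Longrightarrow> Z s K (- b) \<le> C"
  shows "norm (s k) \<le> slope_bound C k"
proof -
  have *: "s k \<bullet> t \<le> ln (C / (\<integral>x. tilt (\<lambda>_. 0) k t x \<partial>lborel))" if "Z s K t \<le> C" for t
  proof -
    let ?I = "\<integral>x. tilt (\<lambda>_. 0) k t x \<partial>lborel"
    have I: "?I > 0" by (intro integral_lborel_pos integrable_tilt tilt_pos)
    have "exp (s k \<bullet> t) * ?I = (\<integral>x. tilt s k t x \<partial>lborel)"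
      by (simp add: tilt_def exp_add[symmetric] algebra_simps flip: integral_mult_right_zero)
    also have "\<dots> \<le> Z s K t"
      unfolding Z_def by (intro integral_mono integrable_tilt integrable_envelope tilt_le_envelope K)
    finally have "exp (s k \<bullet> t) * ?I \<le> C" using that by simp
    then have "exp (s k \<bullet> t) \<le> C / ?I" using I by (simp add: field_simps)
    moreover from this have "0 < C / ?I" using exp_gt_zero less_le_trans by blast
    ultimately show ?thesis using ln_ge_iff by blast
  qed
  have "norm (s k) \<le> (\<Sum>b\<in>Basis. \<bar>s k \<bullet> b\<bar>)" by (rule norm_le_l1)
  also have "\<dots> \<le> slope_bound C k"
    unfolding slope_bound_def
  proof (rule sum_mono)
    fix b :: 'a assume b: "b \<in> Basis"
    show "\<bar>s k \<bullet> b\<bar> \<le> \<bar>ln (C / (\<integral>x. tilt (\<lambda>_. 0) k b x \<partial>lborel))\<bar> + \<bar>ln (C / (\<integral>x. tilt (\<lambda>_. 0) k (- b) x \<partial>lborel))\<bar>"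
      using *[OF C(1)[OF b]] *[OF C(2)[OF b]] by simp
  qed
  finally show ?thesis .
qed

section \<open>The finite minimisation problem\<close>

lemma Z_nonneg: "finite K \<Longrightarrow> 0 \<le> Z s K t"
  unfolding Z_def by (intro Bochner_Integration.integral_nonneg envelope_nonneg)

lemma Z_pos:
  assumes K: "finite K" "k \<in> K"
  shows "0 < Z s K t"
  unfolding Z_def using K
  by (intro integral_lborel_pos integrable_envelope) (auto intro: less_le_trans[OF tilt_pos tilt_le_envelope])

text \<open>The direct method: a minimising sequence has bounded slopes since \<open>T\<close>
  contains all \<open>\<plusminus>b\<close>, so a subsequence converges, and the objective is
  continuous.\<close>

lemma exists_minimizer:
  assumes K: "finite K" and T: "finite T" "\<And>b. b \<in> Basis \<Longrightarrow> b \<in> T \<and> - b \<in> T" and p: "p \<ge> 1"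
  shows "\<exists>s. \<forall>s'. (\<Sum>t\<in>T. Z s K t ^ p) \<le> (\<Sum>t\<in>T. Z s' K t ^ p)"
proof -
  define J where "J s = (\<Sum>t\<in>T. Z s K t ^ p)" for s
  have J0: "0 \<le> J s" for s unfolding J_def using Z_nonneg[OF K] by (intro sum_nonneg) simp
  then have bdd: "bdd_below (range J)" by (intro bdd_belowI[of _ 0]) auto
  have "\<exists>s. J s < Inf (range J) + 1 / real (Suc n) \<and> (\<forall>k. k \<notin> K \<longrightarrow> s k = 0)" for n
  proof -
    obtain s where s: "J s < Inf (range J) + 1 / real (Suc n)"
      using cInf_lessD[of "range J" "Inf (range J) + 1 / real (Suc n)"] by auto
    \<comment> \<open>Slopes outside \<open>K\<close> do not affect the objective; setting them to 0
      keeps every coordinate bounded.\<close>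
    let ?s = "\<lambda>k. if k \<in> K then s k else 0"
    have "envelope ?s K = envelope s K" by (intro ext envelope_cong) simp
    then have "J ?s = J s" unfolding J_def Z_def by simp
    then show ?thesis using s by (intro exI[of _ ?s]) simp
  qed
  then obtain S where S: "\<And>n. J (S n) < Inf (range J) + 1 / real (Suc n)" "\<And>n k. k \<notin> K \<Longrightarrow> S n k = 0"
    by metis
  \<comment> \<open>The \<open>+ 1\<close> covers the error in the minimising sequence and makes
    \<open>C\<close> at least 1, so that a bound on \<open>Z ^ p\<close> is also a bound on
    \<open>Z\<close>.\<close>
  define C where "C = Inf (range J) + 1"
  have Inf0: "0 \<le> Inf (range J)" using J0 by (intro cInf_greatest) auto
  have ZC: "Z (S n) K t \<le> C" if "t \<in> T" for n t
  proof -
    have "1 / real (Suc n) \<le> 1" by simp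
    then have "J (S n) \<le> C" using S(1)[of n] unfolding C_def by linarith
    moreover have "Z (S n) K t ^ p \<le> J (S n)"
      unfolding J_def using T that Z_nonneg[OF K] by (intro member_le_sum) auto
    ultimately have le: "Z (S n) K t ^ p \<le> C" by simp
    show ?thesis
    proof (cases "Z (S n) K t \<le> 1")
      case True
      then show ?thesis unfolding C_def using Inf0 by simp
    next
      case False
      then have "Z (S n) K t ^ 1 \<le> Z (S n) K t ^ p" using p by (intro power_increasing) auto
      then show ?thesis using le by simp
    qed
  qed
  have "norm (S n k) \<le> (if k \<in> K then slope_bound C k else 0)" for n k
    using norm_le_slope_bound[OF K, of k "S n" C] ZC T(2) S(2) by auto
  from bounded_coordinates_subseq[of S, OF this]
  obtain s r where r: "strict_mono r" and s: "\<And>k. (\<lambda>n. S (r n) k) \<longlonglongrightarrow> s k" by blast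
  have lim: "(\<lambda>n. J (S (r n))) \<longlonglongrightarrow> J s"
    unfolding J_def using s by (intro tendsto_sum tendsto_power Z_tendsto[OF K]) auto
  have "(\<lambda>n. 1 / real (Suc (r n))) \<longlonglongrightarrow> 0"
    using LIMSEQ_subseq_LIMSEQ[OF LIMSEQ_Suc[OF lim_const_over_n[of "1::real"]] r] by (simp add: comp_def)
  then have "(\<lambda>n. Inf (range J) + 1 / real (Suc (r n))) \<longlonglongrightarrow> Inf (range J)"
    using tendsto_add[OF tendsto_const] by fastforce
  then have "J s \<le> Inf (range J)"
    by (rule LIMSEQ_le[OF lim]) (use S(1) in \<open>auto intro: less_imp_le\<close>)
  then have "J s \<le> J s'" for s'
    using cInf_lower[OF rangeI bdd, of s'] by simp
  then show ?thesis unfolding J_def by blast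
qed

text \<open>At a minimiser the derivative in each slope vanishes, so the weights
  \<open>w t k\<close> have barycentre 0 for each \<open>k\<close>. Jensen's inequality for
  \<open>- ln (M s K k t)\<close> is then the hypothesis of
  \<open>sum_power_le_card_of_log_concave\<close>.\<close>

lemma exists_slopes_sum_power_le:
  assumes K: "finite K" "inj_on y K" and T: "finite T" "\<And>b. b \<in> Basis \<Longrightarrow> b \<in> T \<and> - b \<in> T" and p: "p \<ge> 1"
    and Z0: "\<And>s. Z s K 0 \<le> 1"
  shows "\<exists>s. (\<Sum>t\<in>T. Z s K t ^ p) \<le> card T"
proof (cases "K = {}")
  case True
  then show ?thesis using p by (simp add: Z_def power_0_left)
next
  case False
  obtain s where min: "\<And>s'. (\<Sum>t\<in>T. Z s K t ^ p) \<le> (\<Sum>t\<in>T. Z s' K t ^ p)"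
    using exists_minimizer[OF K(1) T p] by blast
  define w where "w t k = Z s K t ^ (p - 1) * M s K k t" for t k
  have pos: "Z s K t > 0" for t using False K by (auto intro: Z_pos)
  have crit: "(\<Sum>t\<in>T. w t k *\<^sub>R t) = 0" if k: "k \<in> K" for k
  proof -
    have "v \<bullet> (\<Sum>t\<in>T. w t k *\<^sub>R t) = 0" for v
    proof -
      let ?s = "\<lambda>\<epsilon>. s(k := s k + \<epsilon> *\<^sub>R v)"
      have "((\<lambda>\<epsilon>. \<Sum>t\<in>T. Z (?s \<epsilon>) K t ^ p) has_real_derivative
          (\<Sum>t\<in>T. real p * Z (?s 0) K t ^ (p - 1) * ((v \<bullet> t) * M s K k t))) (at 0)"
      proof (rule DERIV_sum)
        fix t
        show "((\<lambda>\<epsilon>. Z (?s \<epsilon>) K t ^ p) has_real_derivative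
          real p * Z (?s 0) K t ^ (p - 1) * ((v \<bullet> t) * M s K k t)) (at 0)"
          using DERIV_power[OF has_derivative_Z[OF K k, of s v t], of p] by (simp add: mult_ac)
      qed
      moreover have "\<forall>\<epsilon>. \<bar>0 - \<epsilon>\<bar> < 1 \<longrightarrow> (\<Sum>t\<in>T. Z (?s 0) K t ^ p) \<le> (\<Sum>t\<in>T. Z (?s \<epsilon>) K t ^ p)"
        using min by simp
      ultimately have "(\<Sum>t\<in>T. real p * Z (?s 0) K t ^ (p - 1) * ((v \<bullet> t) * M s K k t)) = 0"
        by (rule DERIV_local_min[OF _ zero_less_one])
      then have "real p * (v \<bullet> (\<Sum>t\<in>T. w t k *\<^sub>R t)) = 0"
        by (simp add: w_def inner_sum_right sum_distrib_left mult_ac)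
      then show ?thesis using p by simp
    qed
    from this[of "\<Sum>t\<in>T. w t k *\<^sub>R t"] show ?thesis by simp
  qed
  have "(\<Sum>t\<in>T. Z s K t ^ p) \<le> card T"
  proof (rule sum_power_le_card_of_log_concave[where K=K and M="\<lambda>t k. M s K k t" and ?M0.0="\<lambda>k. M s K k 0" and w=w])
    show "(\<Sum>k\<in>K. M s K k 0) \<le> 1" using Z0[of s] Z_eq_sum_M[OF K] by simp
    fix k assume k: "k \<in> K" and V: "0 < (\<Sum>t\<in>T. w t k)"
    define V where "V = (\<Sum>t\<in>T. w t k)"
    \<comment> \<open>Jensen's inequality is applied only at points of positive weight, where the
      mass is positive and its logarithm meaningful.\<close>
    define T' where "T' = {t\<in>T. w t k > 0}"
    have wn: "w t k \<ge> 0" for t unfolding w_def using pos[of t] M_nonneg by simp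
    have sub: "T' \<subseteq> T" "\<And>t. t \<in> T - T' \<Longrightarrow> w t k = 0"
      using wn by (auto simp: T'_def less_le)
    have V1: "V > 0" using V by (simp add: V_def)
    have sumT': "(\<Sum>t\<in>T'. w t k / V) = 1"
      using V1 sum.mono_neutral_left[OF T(1) sub(1), of "\<lambda>t. w t k / V"] sub(2)
      by (simp add: V_def flip: sum_divide_distrib)
    then have ne: "T' \<noteq> {}" by auto
    have fT': "finite T'" using T by (simp add: T'_def)
    have "0 < M s K k t" if "t \<in> T'" for t
      using that M_nonneg[of s K k t] unfolding T'_def w_def by (cases "M s K k t = 0") auto
    then have mem: "\<And>t. t \<in> T' \<Longrightarrow> t \<in> {t. 0 < M s K k t}" by simp
    have "(\<Sum>t\<in>T'. (w t k / V) *\<^sub>R t) = (1 / V) *\<^sub>R (\<Sum>t\<in>T. w t k *\<^sub>R t)"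
      using sum.mono_neutral_left[OF T(1) sub(1), of "\<lambda>t. (w t k / V) *\<^sub>R t"] sub(2)
      by (simp add: scaleR_sum_right)
    then have zero: "(\<Sum>t\<in>T'. (w t k / V) *\<^sub>R t) = 0" using crit[OF k] by simp
    note cvx = convex_on_neg_ln_M[OF K(1), of s k]
    \<comment> \<open>The positivity set is convex, so it contains the barycentre, which is
      \<open>0\<close>.\<close>
    have "(\<Sum>t\<in>T'. (w t k / V) *\<^sub>R t) \<in> {t. 0 < M s K k t}"
      using cvx sumT' fT' mem V1 wn by (intro convex_sum) (auto simp: convex_on_def)
    then have M0: "0 < M s K k 0" using zero by simp
    have "- ln (M s K k (\<Sum>t\<in>T'. (w t k / V) *\<^sub>R t)) \<le> (\<Sum>t\<in>T'. (w t k / V) * - ln (M s K k t))"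
      using V1 wn by (intro convex_on_sum[OF fT' ne cvx sumT' _ mem]) auto
    also have "\<dots> = - (\<Sum>t\<in>T. w t k * ln (M s K k t)) / V"
      using sum.mono_neutral_left[OF T(1) sub(1), of "\<lambda>t. (w t k / V) * - ln (M s K k t)"] sub(2)
      by (simp add: sum_divide_distrib sum_negf)
    finally have "(\<Sum>t\<in>T. w t k * ln (M s K k t)) / V \<le> ln (M s K k 0)" using zero by simp
    then have "(\<Sum>t\<in>T. w t k * ln (M s K k t)) \<le> V * ln (M s K k 0)"
      using V1 by (simp add: field_simps)
    with M0 show "0 < M s K k 0 \<and> (\<Sum>t\<in>T. w t k * ln (M s K k t)) \<le> (\<Sum>t\<in>T. w t k) * ln (M s K k 0)"
      by (simp add: V_def)
  qed (use K T p pos in \<open>auto simp: M_nonneg Z_eq_sum_M w_def\<close>)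
  then show ?thesis by blast
qed

section \<open>Lower semicontinuity of the mass in \<open>t\<close>\<close>

lemma nn_integral_envelope: "finite K \<Longrightarrow> (\<integral>\<^sup>+x. ennreal (envelope s K t x) \<partial>lborel) = ennreal (Z s K t)"
  unfolding Z_def by (intro nn_integral_eq_integral integrable_envelope AE_I2 envelope_nonneg)

lemma envelope_tendsto_point:
  assumes "finite K" "\<tau> \<longlonglongrightarrow> t"
  shows "(\<lambda>n. envelope s K (\<tau> n) x) \<longlonglongrightarrow> envelope s K t x"
  using assms(1)
proof (induction K rule: finite_induct)
  case (insert k K)
  have "(\<lambda>n. (\<lambda>(t, x). tilt s k t x) (\<tau> n, x)) \<longlonglongrightarrow> (\<lambda>(t, x). tilt s k t x) (t, x)"
    by (rule continuous_on_tendsto_compose[OF continuous_tilt]) (auto intro: tendsto_intros assms(2))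
  then show ?case using insert by (simp add: envelope_insert tendsto_max)
qed simp

text \<open>The envelopes converge pointwise as \<open>\<tau> n\<close> tends to \<open>t\<close>,
  and Fatou's lemma preserves the upper bound.\<close>

lemma Z_le_of_tendsto:
  assumes K: "finite K" and \<tau>: "\<tau> \<longlonglongrightarrow> t" and le: "\<And>n. Z s K (\<tau> n) \<le> C"
  shows "Z s K t \<le> C"
proof -
  have "(\<integral>\<^sup>+x. ennreal (envelope s K t x) \<partial>lborel) = (\<integral>\<^sup>+x. liminf (\<lambda>n. ennreal (envelope s K (\<tau> n) x)) \<partial>lborel)"
    using envelope_tendsto_point[OF K \<tau>]
    by (intro nn_integral_cong lim_imp_Liminf[symmetric] tendsto_ennrealI) auto
  also have "\<dots> \<le> liminf (\<lambda>n. \<integral>\<^sup>+x. ennreal (envelope s K (\<tau> n) x) \<partial>lborel)"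
    using measurable_envelope[OF K] by (intro nn_integral_liminf) auto
  also have "\<dots> \<le> ennreal C"
    unfolding nn_integral_envelope[OF K] by (intro Liminf_le always_eventually allI ennreal_leI le) simp
  finally have "ennreal (Z s K t) \<le> ennreal C" unfolding nn_integral_envelope[OF K] .
  moreover have "0 \<le> C" using Z_nonneg[OF K] le order_trans by blast
  ultimately show ?thesis by simp
qed

end

section \<open>The limit\<close>

text \<open>A set with null complement is dense, and a convex set has the same interior as its
  closure.\<close>

lemma AE_convex_imp_UNIV:
  fixes S :: "'b::euclidean_space set"
  assumes "convex S" "AE x in lborel. x \<in> S"
  shows "S = UNIV"
proof -
  obtain N where N: "N \<in> null_sets lborel" "- S \<subseteq> N"
    using assms(2) by (auto simp: eventually_ae_filter)
  then have "negligible N"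
    by (auto simp: negligible_iff_null_sets intro: null_sets_completionI)
  then have "negligible (- closure S)"
    by (rule negligible_subset) (use N(2) closure_subset in blast)
  then have "- closure S = {}"
    using open_not_negligible[of "- closure S"] by blast
  then have "closure S = UNIV" by auto
  then have "interior S = UNIV"
    using convex_interior_closure[OF assms(1)] by simp
  then show ?thesis using interior_subset by blast
qed

lemma exists_dense_sequence: "\<exists>d :: nat \<Rightarrow> 'b::euclidean_space. closure (range d) = UNIV"
proof -
  obtain D :: "'b set" where D: "countable D" "\<And>X. open X \<Longrightarrow> X \<noteq> {} \<Longrightarrow> \<exists>d\<in>D. d \<in> X"
    using countable_dense_exists by metis
  then have "D \<noteq> {}" by blast
  then have "range (from_nat_into D) = D" using D(1) by (simp add: range_from_nat_into)
  moreover have "closure D = UNIV"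
  proof -
    have "- closure D = {}"
      using D(2)[of "- closure D"] closure_subset[of D] by blast
    then show ?thesis by auto
  qed
  ultimately show ?thesis by metis
qed

theorem convex_extension:
  fixes \<phi> :: "'a::euclidean_space \<times> 'b::euclidean_space \<Rightarrow> real" and \<psi> :: "'b \<Rightarrow> real"
  assumes \<phi>: "convex_on UNIV \<phi>" and \<psi>: "convex_on UNIV \<psi>"
    and int: "(\<integral>\<^sup>+x. ennreal (exp (\<psi> x - \<phi> (0, x))) \<partial>lborel) \<le> 1"
  shows "\<exists>\<Psi>. convex_on UNIV \<Psi> \<and> (\<forall>x. \<Psi> (0, x) = \<psi> x) \<and>
    (\<forall>t. (\<integral>\<^sup>+x. ennreal (exp (\<Psi> (t, x) - \<phi> (t, x))) \<partial>lborel) \<le> 1)"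
proof -
  \<comment> \<open>The affine pieces are tangents to \<open>\<psi>\<close> at a dense sequence of
    points; agreement there suffices by continuity.\<close>
  obtain q :: "nat \<Rightarrow> 'b" where q: "closure (range q) = UNIV"
    using exists_dense_sequence by blast
  have "\<forall>k. \<exists>y. \<forall>z. \<psi> (q k) + y \<bullet> (z - q k) \<le> \<psi> z"
    using convex_on_subgradient[OF \<psi>] by blast
  then obtain y where y: "\<And>k z. \<psi> (q k) + y k \<bullet> (z - q k) \<le> \<psi> z" by metis
  define c where "c k = \<psi> (q k) - y k \<bullet> q k" for k
  have l_le: "y k \<bullet> z + c k \<le> \<psi> z" for k z
    using y[of k z] by (simp add: c_def inner_diff_right)
  have l_eq: "y k \<bullet> q k + c k = \<psi> (q k)" for k by (simp add: c_def)
  interpret affine_family \<phi> y c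
  proof
    fix k
    have "(\<integral>\<^sup>+x. ennreal (exp (y k \<bullet> x + c k - \<phi> (0, x))) \<partial>lborel) \<le> (\<integral>\<^sup>+x. ennreal (exp (\<psi> x - \<phi> (0, x))) \<partial>lborel)"
      using l_le by (intro nn_integral_mono ennreal_leI) auto
    then show "(\<integral>\<^sup>+x. ennreal (exp (y k \<bullet> x + c k - \<phi> (0, x))) \<partial>lborel) < \<infinity>"
      using int by (auto simp: less_top[symmetric] top_unique)
  qed (rule \<phi>)
  \<comment> \<open>Keeping only the first index of each slope makes \<open>y\<close> injective, as
    the absence of ties requires.\<close>
  define Kinf where "Kinf = {k. \<forall>j<k. y j \<noteq> y k}"
  define K where "K n = {k \<in> Kinf. k < n}" for n
  have fin: "finite (K n)" for n by (simp add: K_def)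
  have inj: "inj_on y (K n)" for n
    by (rule inj_onI) (metis (mono_tags, lifting) K_def Kinf_def linorder_neqE_nat mem_Collect_eq)
  \<comment> \<open>No piece is lost: two affine minorants of equal slope that both touch
    \<open>\<psi>\<close> have the same constant term.\<close>
  have repr: "\<exists>j\<in>Kinf. y j = y k \<and> c j = c k" for k
  proof -
    define j where "j = (LEAST j. y j = y k)"
    have j: "y j = y k" unfolding j_def by (rule LeastI) simp
    have "y i \<noteq> y k" if "i < j" for i
      using that unfolding j_def by (rule not_less_Least)
    then have "j \<in> Kinf" by (simp add: Kinf_def j)
    moreover have "c j = c k"
      using l_le[of j "q k"] l_eq[of k] l_le[of k "q j"] l_eq[of j] j by simp
    ultimately show ?thesis using j by blast
  qed
  have Z0: "Z s (K n) 0 \<le> 1" for s n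
  proof -
    have "envelope s (K n) 0 x \<le> exp (\<psi> x - \<phi> (0, x))" for x
      unfolding envelope_def using fin[of n] l_le by (auto simp: tilt_def)
    then have "(\<integral>\<^sup>+x. ennreal (envelope s (K n) 0 x) \<partial>lborel) \<le> (\<integral>\<^sup>+x. ennreal (exp (\<psi> x - \<phi> (0, x))) \<partial>lborel)"
      by (intro nn_integral_mono ennreal_leI)
    then have "ennreal (Z s (K n) 0) \<le> 1"
      using int unfolding nn_integral_envelope[OF fin] by (rule order_trans)
    then show ?thesis by simp
  qed
  obtain d :: "nat \<Rightarrow> 'a" where d: "closure (range d) = UNIV"
    using exists_dense_sequence by blast
  \<comment> \<open>The signed basis vectors are present for every \<open>n\<close> so that the
    slope bound always applies.\<close>
  define T where "T n = Basis \<union> uminus ` Basis \<union> d ` {..<n}" for n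
  have "\<exists>s. \<forall>t\<in>T n. Z s (K n) t \<le> 1 + 1 / real (Suc n)" for n
  proof -
    let ?e = "1 + 1 / real (Suc n)"
    \<comment> \<open>With the exponent this large, a bound \<open>card (T n)\<close> on the sum of
      powers bounds each single \<open>Z\<close> by \<open>?e\<close>.\<close>
    obtain p where p: "real (card (T n)) < ?e ^ p" using real_arch_pow[of ?e] by auto
    have "?e ^ p \<le> ?e ^ Suc p" by (intro power_increasing) auto
    with p have p: "real (card (T n)) \<le> ?e ^ Suc p" by linarith
    obtain s where s: "(\<Sum>t\<in>T n. Z s (K n) t ^ Suc p) \<le> card (T n)"
    proof -
      have "finite (T n)" "\<And>b. b \<in> Basis \<Longrightarrow> b \<in> T n \<and> - b \<in> T n" by (auto simp: T_def)
      from exists_slopes_sum_power_le[OF fin[of n] inj this _ Z0, of "Suc p"] that show ?thesis by (force simp del: power_Suc)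
    qed
    have "Z s (K n) t \<le> ?e" if t: "t \<in> T n" for t
    proof -
      have "Z s (K n) t ^ Suc p \<le> (\<Sum>t\<in>T n. Z s (K n) t ^ Suc p)"
        using t Z_nonneg[OF fin] by (intro member_le_sum zero_le_power) (auto simp: T_def)
      then have "Z s (K n) t ^ Suc p \<le> ?e ^ Suc p" using s p by linarith
      then show ?thesis by (rule power_le_imp_le_base) simp
    qed
    then show ?thesis by blast
  qed
  then obtain S0 where S0: "\<And>n t. t \<in> T n \<Longrightarrow> Z (S0 n) (K n) t \<le> 1 + 1 / real (Suc n)" by metis
  \<comment> \<open>Zero slopes outside \<open>K n\<close> make every coordinate bounded uniformly
    in \<open>n\<close>, including those not yet in use.\<close>
  define S where "S n k = (if k \<in> K n then S0 n k else 0)" for n k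
  have "envelope (S n) (K n) = envelope (S0 n) (K n)" for n
    by (intro ext envelope_cong) (simp add: S_def)
  then have S: "Z (S n) (K n) t \<le> 1 + 1 / real (Suc n)" if "t \<in> T n" for n t
    using S0[OF that] by (simp add: Z_def)
  have "norm (S n k) \<le> slope_bound 2 k" for n k
  proof (cases "k \<in> K n")
    case True
    have "1 + 1 / real (Suc n) \<le> 2" by simp
    then have "Z (S n) (K n) t \<le> 2" if "t \<in> T n" for t using S[OF that] by linarith
    then show ?thesis by (intro norm_le_slope_bound[OF fin True]) (auto simp: T_def)
  next
    case False
    then show ?thesis by (auto simp: S_def slope_bound_def intro!: sum_nonneg)
  qed
  from bounded_coordinates_subseq[of S, OF this]
  obtain s r where r: "strict_mono r" and s: "\<And>k. (\<lambda>n. S (r n) k) \<longlonglongrightarrow> s k" by blast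
  have K_mono: "K m \<subseteq> K n" if "m \<le> n" for m n using that by (auto simp: K_def)
  have dense_le: "Z s (K n) (d i) \<le> 1" for n i
  proof (rule LIMSEQ_le)
    show "(\<lambda>m. Z (S (r m)) (K n) (d i)) \<longlonglongrightarrow> Z s (K n) (d i)"
      by (rule Z_tendsto[OF fin s])
    have "(\<lambda>m. 1 / real (Suc (r m))) \<longlonglongrightarrow> 0"
      using LIMSEQ_subseq_LIMSEQ[OF LIMSEQ_Suc[OF lim_const_over_n[of "1::real"]] r] by (simp add: comp_def)
    then show "(\<lambda>m. 1 + 1 / real (Suc (r m))) \<longlonglongrightarrow> 1"
      using tendsto_add[OF tendsto_const[of "1::real"]] by fastforce
    \<comment> \<open>From this \<open>m\<close> on, \<open>K n\<close> is contained in
      \<open>K (r m)\<close> and \<open>d i\<close> belongs to \<open>T (r m)\<close>; enlarging the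
      index set only increases \<open>Z\<close>.\<close>
    have "Z (S (r m)) (K n) (d i) \<le> 1 + 1 / real (Suc (r m))" if m: "max n (Suc i) \<le> m" for m
    proof -
      have rm: "m \<le> r m" using r by (rule seq_suble)
      have "Z (S (r m)) (K n) (d i) \<le> Z (S (r m)) (K (r m)) (d i)"
        unfolding Z_def using rm m by (intro integral_mono integrable_envelope fin envelope_mono K_mono) auto
      also have "\<dots> \<le> 1 + 1 / real (Suc (r m))"
        using rm m by (intro S) (auto simp: T_def)
      finally show ?thesis .
    qed
    then show "\<exists>N. \<forall>m\<ge>N. Z (S (r m)) (K n) (d i) \<le> 1 + 1 / real (Suc (r m))" by blast
  qed
  have Z_le: "Z s (K n) t \<le> 1" for n t
  proof -
    have "t \<in> closure (range d)" using d by simp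
    then obtain \<tau> where \<tau>: "\<And>n. \<tau> n \<in> range d" "\<tau> \<longlonglongrightarrow> t"
      unfolding closure_sequential by blast
    show ?thesis
    proof (rule Z_le_of_tendsto[OF fin \<tau>(2)])
      show "Z s (K n) (\<tau> m) \<le> 1" for m
        using \<tau>(1)[of m] dense_le by auto
    qed
  qed
  \<comment> \<open>The supremum is taken in \<open>ennreal\<close>, so that monotone convergence is
    available before finiteness is known.\<close>
  define G where "G t x = (SUP n. ennreal (envelope s (K n) t x))" for t x
  have G_int: "(\<integral>\<^sup>+x. G t x \<partial>lborel) \<le> 1" for t
  proof -
    have "(\<integral>\<^sup>+x. G t x \<partial>lborel) = (SUP n. \<integral>\<^sup>+x. ennreal (envelope s (K n) t x) \<partial>lborel)"
      unfolding G_def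
    proof (rule nn_integral_monotone_convergence_SUP)
      show "incseq (\<lambda>n x. ennreal (envelope s (K n) t x))"
        by (auto simp: incseq_def le_fun_def intro!: ennreal_leI envelope_mono fin K_mono)
      show "(\<lambda>x. ennreal (envelope s (K n) t x)) \<in> borel_measurable lborel" for n
        using measurable_envelope[OF fin[of n]] by auto
    qed
    also have "\<dots> \<le> 1"
      unfolding nn_integral_envelope[OF fin] using Z_le by (intro SUP_least) simp
    finally show ?thesis .
  qed
  have G_meas: "G t \<in> borel_measurable lborel" for t
    unfolding G_def using measurable_envelope[OF fin] by (intro borel_measurable_SUP) auto
  define L where "L k t x = y k \<bullet> x + c k + s k \<bullet> t" for k t x
  have tilt_le_G: "ennreal (tilt s k t x) \<le> G t x" if "k \<in> Kinf" for k t x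
  proof -
    have "ennreal (tilt s k t x) \<le> ennreal (envelope s (K (Suc k)) t x)"
      using that by (intro ennreal_leI tilt_le_envelope[OF fin]) (simp add: K_def)
    also have "\<dots> \<le> G t x" unfolding G_def by (rule SUP_upper) simp
    finally show ?thesis .
  qed
  have tilt_L: "tilt s k t x = exp (L k t x - \<phi> (t, x))" for k t x
    by (simp add: tilt_def L_def)
  have zero_in: "0 \<in> Kinf" by (simp add: Kinf_def)
  have L_le: "L k t x \<le> \<phi> (t, x) + ln g" if "k \<in> Kinf" "G t x = ennreal g" "g > 0" for k t x g
  proof -
    have "tilt s k t x \<le> g" using tilt_le_G[OF that(1), of t x] that by simp
    then have "L k t x - \<phi> (t, x) \<le> ln g" unfolding tilt_L using that(3) by (simp add: ln_ge_iff)
    then show ?thesis by simp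
  qed
  have G_pos: "g > 0" if "G t x = ennreal g" for t x g
    using tilt_le_G[OF zero_in, of t x] tilt_pos[of s 0 t x] that by (metis ennreal_less_zero_iff less_le_trans)
  \<comment> \<open>Integrability of \<open>G t\<close> gives a finite supremum only for almost
    every \<open>x\<close>. Since \<open>L k t\<close> is affine, the set of such \<open>x\<close>
    is convex, hence everything.\<close>
  have bdd: "bdd_above ((\<lambda>k. L k t x) ` Kinf)" for t x
  proof -
    let ?B = "{x. bdd_above ((\<lambda>k. L k t x) ` Kinf)}"
    have "convex ?B"
    proof (rule convexI)
      fix x x' and u v :: real
      assume "x \<in> ?B" "x' \<in> ?B" and uv: "0 \<le> u" "0 \<le> v" "u + v = 1"
      then obtain b b' where b: "\<And>k. k \<in> Kinf \<Longrightarrow> L k t x \<le> b" "\<And>k. k \<in> Kinf \<Longrightarrow> L k t x' \<le> b'"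
        by (auto simp: bdd_above_def)
      have "L k t (u *\<^sub>R x + v *\<^sub>R x') = u * L k t x + v * L k t x'" for k
      proof -
        have "(u + v) * (c k + s k \<bullet> t) = c k + s k \<bullet> t" using uv by simp
        then show ?thesis by (simp add: L_def inner_add_right algebra_simps)
      qed
      then have "L k t (u *\<^sub>R x + v *\<^sub>R x') \<le> u * b + v * b'" if "k \<in> Kinf" for k
        using b[OF that] uv by (auto intro: add_mono mult_left_mono)
      then show "u *\<^sub>R x + v *\<^sub>R x' \<in> ?B" by (auto simp: bdd_above_def)
    qed
    moreover have "AE x in lborel. x \<in> ?B"
    proof -
      have "(\<integral>\<^sup>+x. G t x \<partial>lborel) \<noteq> \<infinity>" using G_int[of t] by (auto simp: top_unique)
      then have "AE x in lborel. G t x \<noteq> \<infinity>" by (rule nn_integral_noteq_infinite[OF G_meas])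
      then show ?thesis
      proof eventually_elim
        case (elim x)
        then obtain g where g: "G t x = ennreal g" by (cases "G t x") auto
        show ?case using L_le[OF _ g G_pos[OF g]] by (auto simp: bdd_above_def)
      qed
    qed
    ultimately have "?B = UNIV" by (rule AE_convex_imp_UNIV)
    then have "x \<in> ?B" by (simp only: UNIV_I)
    then show ?thesis by simp
  qed
  define \<Psi> where "\<Psi> z = (SUP k\<in>Kinf. L k (fst z) (snd z))" for z
  have L_le_\<Psi>: "L k t x \<le> \<Psi> (t, x)" if "k \<in> Kinf" for k t x
    unfolding \<Psi>_def using that bdd by (auto intro: cSUP_upper)
  have \<Psi>_le: "\<Psi> (t, x) \<le> b" if "\<And>k. k \<in> Kinf \<Longrightarrow> L k t x \<le> b" for t x b
    unfolding \<Psi>_def using that zero_in by (auto intro: cSUP_least)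
  have convex: "convex_on UNIV \<Psi>"
  proof (rule convex_onI)
    fix l :: real and z z' :: "'a \<times> 'b" assume l: "0 < l" "l < 1"
    obtain t x t' x' where z: "z = (t, x)" "z' = (t', x')" by (cases z; cases z')
    have "\<Psi> ((1 - l) *\<^sub>R t + l *\<^sub>R t', (1 - l) *\<^sub>R x + l *\<^sub>R x') \<le> (1 - l) * \<Psi> z + l * \<Psi> z'"
    proof (rule \<Psi>_le)
      fix k assume k: "k \<in> Kinf"
      have "L k ((1 - l) *\<^sub>R t + l *\<^sub>R t') ((1 - l) *\<^sub>R x + l *\<^sub>R x') = (1 - l) * L k t x + l * L k t' x'"
        by (simp add: L_def inner_add_right algebra_simps)
      also have "\<dots> \<le> (1 - l) * \<Psi> z + l * \<Psi> z'"
        using l L_le_\<Psi>[OF k] by (auto simp: z intro!: add_mono mult_left_mono)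
      finally show "L k ((1 - l) *\<^sub>R t + l *\<^sub>R t') ((1 - l) *\<^sub>R x + l *\<^sub>R x') \<le> (1 - l) * \<Psi> z + l * \<Psi> z'" .
    qed
    then show "\<Psi> ((1 - l) *\<^sub>R z + l *\<^sub>R z') \<le> (1 - l) * \<Psi> z + l * \<Psi> z'" by (simp add: z)
  qed simp
  have "\<Psi> (0, x) = \<psi> x" for x
  proof -
    \<comment> \<open>At \<open>q k\<close> the piece \<open>k\<close>, or its representative in
      \<open>Kinf\<close>, touches \<open>\<psi>\<close>; equality elsewhere follows by density of
      the \<open>q k\<close>.\<close>
    have at_q: "\<Psi> (0, q k) = \<psi> (q k)" for k
    proof (rule antisym)
      show "\<Psi> (0, q k) \<le> \<psi> (q k)" by (rule \<Psi>_le) (simp add: L_def l_le)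
      obtain j where j: "j \<in> Kinf" "y j = y k" "c j = c k" using repr by blast
      show "\<psi> (q k) \<le> \<Psi> (0, q k)"
        using L_le_\<Psi>[OF j(1), of 0 "q k"] l_eq[of k] j by (simp add: L_def)
    qed
    have "continuous_on UNIV (\<Psi> \<circ> Pair 0)"
      by (intro continuous_on_compose continuous_intros
          continuous_on_subset[OF convex_on_continuous[OF open_UNIV convex]]) auto
    moreover have "continuous_on UNIV \<psi>" by (rule convex_on_continuous[OF open_UNIV \<psi>])
    ultimately have "closed {x. (\<Psi> \<circ> Pair 0) x = \<psi> x}" by (rule closed_Collect_eq)
    moreover have "range q \<subseteq> {x. (\<Psi> \<circ> Pair 0) x = \<psi> x}" using at_q by auto
    ultimately have "closure (range q) \<subseteq> {x. (\<Psi> \<circ> Pair 0) x = \<psi> x}" by (rule closure_minimal[rotated])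
    then show ?thesis using q by auto
  qed
  moreover have "(\<integral>\<^sup>+x. ennreal (exp (\<Psi> (t, x) - \<phi> (t, x))) \<partial>lborel) \<le> 1" for t
  proof -
    \<comment> \<open>Passing to logarithms shows that each piece, and so their supremum, is below
      \<open>\<phi> (t, x) + ln g\<close>; an infinite \<open>G t x\<close> makes the bound
      trivial.\<close>
    have "ennreal (exp (\<Psi> (t, x) - \<phi> (t, x))) \<le> G t x" for x
    proof (cases "G t x")
      case (real g)
      have g: "g > 0" using G_pos real by blast
      have "\<Psi> (t, x) \<le> \<phi> (t, x) + ln g" by (rule \<Psi>_le) (rule L_le[OF _ _ g], use real in auto)
      then have "exp (\<Psi> (t, x) - \<phi> (t, x)) \<le> exp (ln g)" by simp
      then show ?thesis using real g by (simp add: ennreal_leI)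
    qed simp
    then have "(\<integral>\<^sup>+x. ennreal (exp (\<Psi> (t, x) - \<phi> (t, x))) \<partial>lborel) \<le> (\<integral>\<^sup>+x. G t x \<partial>lborel)"
      by (intro nn_integral_mono)
    then show ?thesis using G_int[of t] by (rule order_trans)
  qed
  ultimately show ?thesis using convex by blast
qed

theorem theorem1p1:
  fixes \<phi> :: "(real ^ 'm) \<times> (real ^ 'n) \<Rightarrow> real"
    and \<psi> :: "real ^ 'n \<Rightarrow> real"
  assumes "convex_on UNIV \<phi>"
    and "convex_on UNIV \<psi>"
    and "(\<integral>\<^sup>+ x. ennreal (exp (\<psi> x - \<phi> (0, x))) \<partial>lborel) = 1"
  shows "\<exists>\<Psi> :: (real ^ 'm) \<times> (real ^ 'n) \<Rightarrow> real.
    convex_on UNIV \<Psi> \<and>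
    (\<forall>x. \<Psi> (0, x) = \<psi> x) \<and>
    (\<forall>t. (\<integral>\<^sup>+ x. ennreal (exp (\<Psi> (t, x) - \<phi> (t, x))) \<partial>lborel) \<le> 1)"
  using assms by (intro convex_extension) auto

end
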